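(* Let $1\le p,p_{1},\dots,p_{m}\le\infty$ with $\frac1p=\frac1{p_{1}}+\dots+\frac1{p_{m}}$. The class $\left(\Pi_{p_{1},\dots,p_{m}}^{+},\pi_{p_{1},\dots,p_{m}}^{+}\right)$ of positive $(p_{1},\dots,p_{m})$-dominated $m$-linear operators is a positive Banach right multi-ideal.
   Context: Scalars are in $\mathbb{K}=\mathbb{R}$ or $\mathbb{C}$. $\mathcal{L}(X;Y)$ and $\mathcal{L}(E_{1},\dots,E_{m};X)$ are the spaces of bounded linear and bounded $m$-linear operators. $E^{+}$ is the positive cone of a Banach lattice $E$; $\mathcal{L}^{+}(E;F)$ is the set of positive bounded linear operators between Banach lattices (mapping $E^{+}$ into $F^{+}$). $\|(x_{i})_{i=1}^{n}\|_{q,w}=\sup_{x^{*}\in B_{X^{*}}}\left(\sum_{i=1}^{n}|\langle x^{*},x_{i}\rangle|^{q}\right)^{1/q}$ for a finite sequence in a Banach space $X$; sums are replaced by maxima when an exponent is $\infty$. For Banach lattices $E_{1},\dots,E_{m}$ and a Banach space $Y$, a bounded $m$-linear $T:E_{1}\times\dots\times E_{m}\to Y$ is positive $(p_{1},\dots,p_{m})$-dominated if there is $C>0$ such that for every $n$ and all $(x_{i}^{1},\dots,x_{i}^{m})\in E_{1}^{+}\times\dots\times E_{m}^{+}$ $(1\le i\le n)$, $$\left(\sum_{i=1}^{n}\|T(x_{i}^{1},\dots,x_{i}^{m})\|^{p}\right)^{1/p}\le C\prod_{j=1}^{m}\|(x_{i}^{j})_{i=1}^{n}\|_{p_{j},w}.$$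 The space of these is $\Pi_{p_{1},\dots,p_{m}}^{+}(E_{1},\dots,E_{m};Y)$ and $\pi_{p_{1},\dots,p_{m}}^{+}(T)$ is the infimum of such $C$. A class $\mathcal{M}_{R}^{+}$ of bounded $m$-linear operators from Banach lattices into Banach spaces, with $\|\cdot\|_{\mathcal{M}_{R}^{+}}:\mathcal{M}_{R}^{+}\to[0,\infty)$, is a positive Banach right multi-ideal if for all Banach lattices $E_{1},\dots,E_{m}$ and every Banach space $X$ the component $\mathcal{M}_{R}^{+}(E_{1},\dots,E_{m};X):=\mathcal{L}(E_{1},\dots,E_{m};X)\cap\mathcal{M}_{R}^{+}$ satisfies: (i) it is a linear subspace of $\mathcal{L}(E_{1},\dots,E_{m};X)$ containing the $m$-linear mappings of finite rank, i.e. of the form $(x^{1},\dots,x^{m})\mapsto\sum_{i=1}^{k}x_{i,1}^{*}(x^{1})\cdots x_{i,m}^{*}(x^{m})\,y_{i}$ with $x_{i,j}^{*}\in E_{j}^{*}$, $y_{i}\in X$; (ii) if $T\in\mathcal{M}_{R}^{+}(E_{1},\dots,E_{m};X)$, $u_{j}\in\mathcal{L}^{+}(G_{j};E_{j})$ with $G_{j}$ Banach lattices $(1\le j\le m)$ and $v\in\mathcal{L}(X;Y)$ with $Y$ a Banach space, then $v\circ T\circ(u_{1},\dots,u_{m})\in\mathcal{M}_{R}^{+}(G_{1},\dots,G_{m};Y)$; a) each component is a Banach space under $\|\cdot\|_{\mathcal{M}_{R}^{+}}$; b) the form $T^{m}:\mathbb{K}^{m}\to\mathbb{K}$, $T^{m}(\lambda^{1},\dots,\lambda^{m})=\lambda^{1}\cdots\lambda^{m}$,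 satisfies $\|T^{m}\|_{\mathcal{M}_{R}^{+}}=1$; c) in the situation of (ii), $\|v\circ T\circ(u_{1},\dots,u_{m})\|_{\mathcal{M}_{R}^{+}}\le\|v\|\,\|T\|_{\mathcal{M}_{R}^{+}}\|u_{1}\|\cdots\|u_{m}\|$. *)

theory Defs
  imports "HOL-Analysis.Analysis" "HOL-Algebra.Module" "HOL-Algebra.Lattice"
begin

text \<open>
  A multi-ideal refers to \<^emph>\<open>all\<close> Banach lattices and \<^emph>\<open>all\<close> Banach spaces, and the factors
  \<open>E\<^sub>1, \<dots>, E\<^sub>m\<close> are unrelated to each other. Spaces are therefore records with an explicit carrier:
  \<open>'a\<close> is the universe in which the carriers of the Banach lattices live, \<open>'b\<close> the one for the
  Banach spaces, and both are arbitrary. The scalar field is a set \<open>K\<close> of complex numbers, namely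
  \<open>\<real>\<close> or \<open>UNIV\<close>; scalar multiplication is only relevant for scalars in \<open>K\<close>.
\<close>

section \<open>Banach spaces\<close>

definition scalar_ring :: "complex set \<Rightarrow> complex ring" where
  "scalar_ring K = \<lparr>carrier = K, mult = (*), one = 1, zero = 0, add = (+)\<rparr>"

text \<open>The ring fields \<open>mult\<close> and \<open>one\<close> inherited from the library's \<open>module\<close> record are irrelevant.\<close>

record 'a nspace = "(complex, 'a) module" +
  vnorm :: "'a \<Rightarrow> real"

definition normed_space :: "complex set \<Rightarrow> ('a, 'z) nspace_scheme \<Rightarrow> bool" where
  "normed_space K X \<longleftrightarrow>
     Module.module (scalar_ring K) X \<and>
     (\<forall>x\<in>carrier X. 0 \<le> vnorm X x) \<and>
     (\<forall>x\<in>carrier X. vnorm X x = 0 \<longleftrightarrow> x = \<zero>\<^bsub>X\<^esub>) \<and>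
     (\<forall>x\<in>carrier X. \<forall>y\<in>carrier X. vnorm X (x \<oplus>\<^bsub>X\<^esub> y) \<le> vnorm X x + vnorm X y) \<and>
     (\<forall>c\<in>K. \<forall>x\<in>carrier X. vnorm X (c \<odot>\<^bsub>X\<^esub> x) = cmod c * vnorm X x)"

text \<open>The locale \<open>Metric_space\<close> wants nonnegativity and symmetry also outside the carrier.\<close>

definition vdist :: "('a, 'z) nspace_scheme \<Rightarrow> 'a \<Rightarrow> 'a \<Rightarrow> real" where
  "vdist X x y = (if x \<in> carrier X \<and> y \<in> carrier X then vnorm X (x \<ominus>\<^bsub>X\<^esub> y) else 0)"

definition banach_space :: "complex set \<Rightarrow> ('a, 'z) nspace_scheme \<Rightarrow> bool" where
  "banach_space K X \<longleftrightarrow>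
     normed_space K X \<and> Metric_space.mcomplete (carrier X) (vdist X)"

definition scalar_space :: "complex set \<Rightarrow> complex nspace" where
  "scalar_space K = \<lparr>carrier = K, mult = (*), one = 1, zero = 0, add = (+),
     smult = (*), vnorm = cmod\<rparr>"

section \<open>Banach lattices\<close>

text \<open>
  The order lives on the real part \<open>rpart E\<close>, which is all of \<open>E\<close> for real scalars, whereas a
  complex Banach lattice is the complexification \<open>E\<^sub>\<real> \<oplus> i E\<^sub>\<real>\<close> of a real one.
\<close>

record 'a lspace = "'a nspace" +
  rpart :: "'a set"
  rle :: "'a \<Rightarrow> 'a \<Rightarrow> bool"

definition rorder :: "('a, 'z) lspace_scheme \<Rightarrow> 'a gorder" where
  "rorder E = \<lparr>carrier = rpart E, eq = (=), le = rle E\<rparr>"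

definition pos_cone :: "('a, 'z) lspace_scheme \<Rightarrow> 'a set" where
  "pos_cone E = {x \<in> rpart E. rle E \<zero>\<^bsub>E\<^esub> x}"

definition rabs :: "('a, 'z) lspace_scheme \<Rightarrow> 'a \<Rightarrow> 'a" where
  "rabs E x = x \<squnion>\<^bsub>rorder E\<^esub> (\<ominus>\<^bsub>E\<^esub> x)"

text \<open>
  The norm of the complexification is \<open>\<parallel>x + i y\<parallel> = \<parallel> |x + i y| \<parallel>\<close> with modulus
  \<open>|x + i y| = sup {(cos t) x + (sin t) y | t}\<close>; in a real Banach lattice this supremum always
  exists, so demanding its existence is no restriction.
\<close>

definition complexification :: "('a, 'z) lspace_scheme \<Rightarrow> bool" where
  "complexification E \<longleftrightarrow>
     (\<forall>z\<in>carrier E. \<exists>!(x, y). x \<in> rpart E \<and> y \<in> rpart E \<and> z = x \<oplus>\<^bsub>E\<^esub> \<i> \<odot>\<^bsub>E\<^esub> y) \<and>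
     (\<forall>x\<in>rpart E. \<forall>y\<in>rpart E. \<exists>s.
        is_lub (rorder E) s
          {of_real (cos t) \<odot>\<^bsub>E\<^esub> x \<oplus>\<^bsub>E\<^esub> of_real (sin t) \<odot>\<^bsub>E\<^esub> y | t :: real. True} \<and>
        vnorm E (x \<oplus>\<^bsub>E\<^esub> \<i> \<odot>\<^bsub>E\<^esub> y) = vnorm E s)"

definition banach_lattice :: "complex set \<Rightarrow> ('a, 'z) lspace_scheme \<Rightarrow> bool" where
  "banach_lattice K E \<longleftrightarrow>
     banach_space K E \<and>
     submodule (rpart E) (scalar_ring \<real>) E \<and>
     Lattice.lattice (rorder E) \<and>
     (\<forall>x\<in>rpart E. \<forall>y\<in>rpart E. \<forall>z\<in>rpart E.
        rle E x y \<longrightarrow> rle E (x \<oplus>\<^bsub>E\<^esub> z) (y \<oplus>\<^bsub>E\<^esub> z)) \<and>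
     (\<forall>x\<in>rpart E. \<forall>y\<in>rpart E. \<forall>c::real.
        rle E x y \<longrightarrow> 0 \<le> c \<longrightarrow> rle E (of_real c \<odot>\<^bsub>E\<^esub> x) (of_real c \<odot>\<^bsub>E\<^esub> y)) \<and>
     (\<forall>x\<in>rpart E. \<forall>y\<in>rpart E.
        rle E (rabs E x) (rabs E y) \<longrightarrow> vnorm E x \<le> vnorm E y) \<and>
     (if K = \<real> then rpart E = carrier E else complexification E)"

definition scalar_lattice :: "complex set \<Rightarrow> complex lspace" where
  "scalar_lattice K = \<lparr>carrier = K, mult = (*), one = 1, zero = 0, add = (+),
     smult = (*), vnorm = cmod, rpart = \<real>, rle = (\<lambda>a b. Re a \<le> Re b)\<rparr>"

section \<open>Bounded linear operators\<close>

definition linear_ops ::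
    "complex set \<Rightarrow> ('a, 'y) nspace_scheme \<Rightarrow> ('b, 'z) nspace_scheme \<Rightarrow> ('a \<Rightarrow> 'b) set" where
  "linear_ops K X Y = {u \<in> carrier X \<rightarrow>\<^sub>E carrier Y.
     (\<forall>x\<in>carrier X. \<forall>y\<in>carrier X. u (x \<oplus>\<^bsub>X\<^esub> y) = u x \<oplus>\<^bsub>Y\<^esub> u y) \<and>
     (\<forall>c\<in>K. \<forall>x\<in>carrier X. u (c \<odot>\<^bsub>X\<^esub> x) = c \<odot>\<^bsub>Y\<^esub> u x) \<and>
     (\<exists>C. \<forall>x\<in>carrier X. vnorm Y (u x) \<le> C * vnorm X x)}"

definition op_norm ::
    "('a, 'y) nspace_scheme \<Rightarrow> ('b, 'z) nspace_scheme \<Rightarrow> ('a \<Rightarrow> 'b) \<Rightarrow> real" where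
  "op_norm X Y u = (SUP x\<in>{x \<in> carrier X. vnorm X x \<le> 1}. vnorm Y (u x))"

abbreviation dual :: "complex set \<Rightarrow> ('a, 'z) nspace_scheme \<Rightarrow> ('a \<Rightarrow> complex) set" where
  "dual K X \<equiv> linear_ops K X (scalar_space K)"

definition dual_ball :: "complex set \<Rightarrow> ('a, 'z) nspace_scheme \<Rightarrow> ('a \<Rightarrow> complex) set" where
  "dual_ball K X = {f \<in> dual K X. op_norm X (scalar_space K) f \<le> 1}"

definition pos_linear_ops ::
    "complex set \<Rightarrow> ('a, 'y) lspace_scheme \<Rightarrow> ('b, 'z) lspace_scheme \<Rightarrow> ('a \<Rightarrow> 'b) set" where
  "pos_linear_ops K E F = {u \<in> linear_ops K E F. u ` pos_cone E \<subseteq> pos_cone F}"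

definition isometric_iso ::
    "complex set \<Rightarrow> ('a, 'y) nspace_scheme \<Rightarrow> ('b, 'z) nspace_scheme \<Rightarrow> ('a \<Rightarrow> 'b) \<Rightarrow> bool" where
  "isometric_iso K X Y f \<longleftrightarrow>
     f \<in> linear_ops K X Y \<and> bij_betw f (carrier X) (carrier Y) \<and>
     (\<forall>x\<in>carrier X. vnorm Y (f x) = vnorm X x)"

section \<open>Bounded multilinear operators\<close>

text \<open>
  The \<open>m\<close> factors are indexed by a finite type \<open>'m\<close>, so \<open>m = CARD('m) \<ge> 1\<close>. Operators are
  \<open>undefined\<close> off the product of the carriers, so that equal operators are equal functions.
\<close>

definition prod_carrier :: "('m \<Rightarrow> ('a, 'z) nspace_scheme) \<Rightarrow> ('m \<Rightarrow> 'a) set" where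
  "prod_carrier E = {x. \<forall>j. x j \<in> carrier (E j)}"

definition multilinear_ops ::
    "complex set \<Rightarrow> ('m::finite \<Rightarrow> ('a, 'y) nspace_scheme) \<Rightarrow> ('b, 'z) nspace_scheme
      \<Rightarrow> (('m \<Rightarrow> 'a) \<Rightarrow> 'b) set" where
  "multilinear_ops K E X = {T \<in> prod_carrier E \<rightarrow>\<^sub>E carrier X.
     (\<forall>x\<in>prod_carrier E. \<forall>j. \<forall>a\<in>carrier (E j). \<forall>b\<in>carrier (E j).
        T (x(j := a \<oplus>\<^bsub>E j\<^esub> b)) = T (x(j := a)) \<oplus>\<^bsub>X\<^esub> T (x(j := b))) \<and>
     (\<forall>x\<in>prod_carrier E. \<forall>j. \<forall>c\<in>K. \<forall>a\<in>carrier (E j).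
        T (x(j := c \<odot>\<^bsub>E j\<^esub> a)) = c \<odot>\<^bsub>X\<^esub> T (x(j := a))) \<and>
     (\<exists>C. \<forall>x\<in>prod_carrier E. vnorm X (T x) \<le> C * (\<Prod>j\<in>UNIV. vnorm (E j) (x j)))}"

definition multilinear_space ::
    "complex set \<Rightarrow> ('m::finite \<Rightarrow> ('a, 'y) nspace_scheme) \<Rightarrow> ('b, 'z) nspace_scheme
      \<Rightarrow> (('m \<Rightarrow> 'a) \<Rightarrow> 'b) nspace" where
  "multilinear_space K E X = \<lparr>carrier = multilinear_ops K E X,
     mult = undefined, one = undefined,
     zero = (\<lambda>x\<in>prod_carrier E. \<zero>\<^bsub>X\<^esub>),
     add = (\<lambda>S T. \<lambda>x\<in>prod_carrier E. S x \<oplus>\<^bsub>X\<^esub> T x),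
     smult = (\<lambda>c T. \<lambda>x\<in>prod_carrier E. c \<odot>\<^bsub>X\<^esub> T x),
     vnorm = (\<lambda>T. SUP x\<in>{x \<in> prod_carrier E. \<forall>j. vnorm (E j) (x j) \<le> 1}. vnorm X (T x))\<rparr>"

definition finite_rank_ops ::
    "complex set \<Rightarrow> ('m::finite \<Rightarrow> ('a, 'y) nspace_scheme) \<Rightarrow> ('b, 'z) nspace_scheme
      \<Rightarrow> (('m \<Rightarrow> 'a) \<Rightarrow> 'b) set" where
  "finite_rank_ops K E X =
     {\<lambda>x\<in>prod_carrier E. finsum X (\<lambda>i. (\<Prod>j\<in>UNIV. f i j (x j)) \<odot>\<^bsub>X\<^esub> y i) {..<k}
      | (k::nat) f y. (\<forall>i<k. \<forall>j. f i j \<in> dual K (E j)) \<and> (\<forall>i<k. y i \<in> carrier X)}"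

definition compose_ops ::
    "('m \<Rightarrow> ('c, 'y) nspace_scheme) \<Rightarrow> ('b \<Rightarrow> 'd) \<Rightarrow> (('m \<Rightarrow> 'a) \<Rightarrow> 'b) \<Rightarrow> ('m \<Rightarrow> 'c \<Rightarrow> 'a)
      \<Rightarrow> (('m \<Rightarrow> 'c) \<Rightarrow> 'd)" where
  "compose_ops G v T u = (\<lambda>x\<in>prod_carrier G. v (T (\<lambda>j. u j (x j))))"

section \<open>Positive Banach right multi-ideals\<close>

text \<open>
  A class of \<open>m\<close>-linear operators is given by its components \<open>M E X\<close>, and \<open>N E X T\<close> is the norm
  of \<open>T\<close> in \<open>M E X\<close>.

  The last but one condition is the normalisation of \<open>T\<^sup>m : K\<^sup>m \<rightarrow> K\<close>. As the carriers live
  in the universes \<open>'a\<close> and \<open>'b\<close>, the field \<open>K\<close> itself is represented there by isomorphic copies,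
  as a Banach lattice \<open>S\<close> in \<open>'a\<close> and as a Banach space \<open>R\<close> in \<open>'b\<close>, and the condition is required
  for all of them. Copies exist in every universe that contains some nonzero space,
  for such a space has at least as many elements as \<open>K\<close>.
\<close>

definition positive_banach_right_multi_ideal ::
    "complex set \<Rightarrow> (('m::finite \<Rightarrow> 'a lspace) \<Rightarrow> 'b nspace \<Rightarrow> (('m \<Rightarrow> 'a) \<Rightarrow> 'b) set)
      \<Rightarrow> (('m \<Rightarrow> 'a lspace) \<Rightarrow> 'b nspace \<Rightarrow> (('m \<Rightarrow> 'a) \<Rightarrow> 'b) \<Rightarrow> real) \<Rightarrow> bool" where
  "positive_banach_right_multi_ideal K M N \<longleftrightarrow>
     (\<forall>E X. (\<forall>j. banach_lattice K (E j)) \<and> banach_space K X \<longrightarrow>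
        submodule (M E X) (scalar_ring K) (multilinear_space K E X) \<and>
        finite_rank_ops K E X \<subseteq> M E X) \<and>
     (\<forall>E X G Y T u v.
        (\<forall>j. banach_lattice K (E j)) \<and> banach_space K X \<and>
        (\<forall>j. banach_lattice K (G j)) \<and> banach_space K Y \<and>
        T \<in> M E X \<and> (\<forall>j. u j \<in> pos_linear_ops K (G j) (E j)) \<and> v \<in> linear_ops K X Y \<longrightarrow>
        compose_ops G v T u \<in> M G Y) \<and>
     (\<forall>E X. (\<forall>j. banach_lattice K (E j)) \<and> banach_space K X \<longrightarrow>
        banach_space K (multilinear_space K E X \<lparr>carrier := M E X, vnorm := N E X\<rparr>)) \<and>
     (\<forall>S R f g.
        banach_lattice K S \<and> isometric_iso K S (scalar_lattice K) f \<and>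
        f ` pos_cone S = pos_cone (scalar_lattice K) \<and>
        banach_space K R \<and> isometric_iso K (scalar_space K) R g \<longrightarrow>
        N (\<lambda>_. S) R (\<lambda>x\<in>prod_carrier (\<lambda>_. S). g (\<Prod>j\<in>UNIV. f (x j))) = 1) \<and>
     (\<forall>E X G Y T u v.
        (\<forall>j. banach_lattice K (E j)) \<and> banach_space K X \<and>
        (\<forall>j. banach_lattice K (G j)) \<and> banach_space K Y \<and>
        T \<in> M E X \<and> (\<forall>j. u j \<in> pos_linear_ops K (G j) (E j)) \<and> v \<in> linear_ops K X Y \<longrightarrow>
        N G Y (compose_ops G v T u)
          \<le> op_norm X Y v * N E X T * (\<Prod>j\<in>UNIV. op_norm (G j) (E j) (u j)))"

section \<open>Positive dominated operators\<close>

text \<open>For \<open>n > 0\<close> and nonnegative \<open>a\<close>.\<close>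

definition lp_norm :: "ennreal \<Rightarrow> nat \<Rightarrow> (nat \<Rightarrow> real) \<Rightarrow> real" where
  "lp_norm q n a =
     (if q = \<infinity> then Max (a ` {..<n})
      else (\<Sum>i<n. a i powr enn2real q) powr (1 / enn2real q))"

definition weak_norm ::
    "complex set \<Rightarrow> ('a, 'z) nspace_scheme \<Rightarrow> ennreal \<Rightarrow> nat \<Rightarrow> (nat \<Rightarrow> 'a) \<Rightarrow> real" where
  "weak_norm K X q n x = (SUP f\<in>dual_ball K X. lp_norm q n (\<lambda>i. cmod (f (x i))))"

definition dominated_bound ::
    "complex set \<Rightarrow> ennreal \<Rightarrow> ('m::finite \<Rightarrow> ennreal) \<Rightarrow> ('m \<Rightarrow> 'a lspace) \<Rightarrow> 'b nspace
      \<Rightarrow> (('m \<Rightarrow> 'a) \<Rightarrow> 'b) \<Rightarrow> real \<Rightarrow> bool" where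
  "dominated_bound K p ps E Y T C \<longleftrightarrow>
     (\<forall>n>0. \<forall>x. (\<forall>i<n. \<forall>j. x i j \<in> pos_cone (E j)) \<longrightarrow>
        lp_norm p n (\<lambda>i. vnorm Y (T (x i)))
          \<le> C * (\<Prod>j\<in>UNIV. weak_norm K (E j) (ps j) n (\<lambda>i. x i j)))"

definition pos_dominated ::
    "complex set \<Rightarrow> ennreal \<Rightarrow> ('m::finite \<Rightarrow> ennreal) \<Rightarrow> ('m \<Rightarrow> 'a lspace) \<Rightarrow> 'b nspace
      \<Rightarrow> (('m \<Rightarrow> 'a) \<Rightarrow> 'b) set" where
  "pos_dominated K p ps E Y =
     {T \<in> multilinear_ops K E Y. \<exists>C>0. dominated_bound K p ps E Y T C}"

definition pos_dominated_norm ::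
    "complex set \<Rightarrow> ennreal \<Rightarrow> ('m::finite \<Rightarrow> ennreal) \<Rightarrow> ('m \<Rightarrow> 'a lspace) \<Rightarrow> 'b nspace
      \<Rightarrow> (('m \<Rightarrow> 'a) \<Rightarrow> 'b) \<Rightarrow> real" where
  "pos_dominated_norm K p ps E Y T = Inf {C. 0 < C \<and> dominated_bound K p ps E Y T C}"

end

theory Submission
  imports Defs
begin

text \<open>
  The difficult axiom is completeness under \<open>\<pi>\<^sup>+\<close>. Domination only sees positive vectors, but they
  determine everything: in a Banach lattice every \<open>z\<close> is \<open>a - b\<close> or \<open>a - b + i(c - d)\<close> with positive
  \<open>a, b, c, d\<close> whose norms are at most twice that of \<open>z\<close>. The case \<open>n = 1\<close> of domination, together with
  \<open>\<parallel>(x)\<parallel>\<^sub>q\<^sub>,\<^sub>w \<le> \<parallel>x\<parallel>\<close>, bounds \<open>\<parallel>T x\<parallel>\<close> by \<open>\<pi>\<^sup>+(T) \<parallel>x\<^sup>1\<parallel> \<cdots> \<parallel>x\<^sup>m\<parallel>\<close> on the positive cones; expanding one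
  factor at a time extends this to all vectors at the price of the constant \<open>6\<^sup>m\<close>
  (\<open>multilinear_bound_of_pos_cone\<close>). Hence \<open>\<pi>\<^sup>+\<close> is definite, a \<open>\<pi>\<^sup>+\<close>-Cauchy sequence converges
  pointwise, and the limit is bounded. Each domination inequality involves finitely many vectors, so
  it passes to pointwise limits (\<open>dbound_limit\<close>), which makes the limit dominated and the convergence
  take place in \<open>\<pi>\<^sup>+\<close> (\<open>banach_dominated_space\<close>).
  
  The relation \<open>1/p = \<Sum>\<^sub>j 1/p\<^sub>j\<close> enters through Hoelder's inequality for several factors
  (\<open>lp_norm_Holder\<close>). It shows that \<open>x \<mapsto> \<Prod>\<^sub>j f\<^sub>j(x\<^sup>j) y\<close> is dominated with constant
  \<open>\<parallel>y\<parallel> \<Prod>\<^sub>j \<parallel>f\<^sub>j\<parallel>\<close>: this gives the finite rank operators and the upper bound in the normalisation,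
  whose lower bound comes from testing on the unit of the scalar lattice. Minkowski's inequality
  (\<open>lp_norm_triangle\<close>) gives the triangle inequality for \<open>\<pi>\<^sup>+\<close>.
  
  For the ideal property, a positive \<open>u\<close> maps positive families to positive families, and it scales
  their weak norms by at most \<open>\<parallel>u\<parallel>\<close> because \<open>f \<circ> u\<close> is a functional of norm at most \<open>\<parallel>u\<parallel>\<close> for
  every \<open>f\<close> in the dual unit ball (\<open>weak_norm_image_le\<close>).
\<close>

section \<open>Norms of finite sequences\<close>

lemma lp_norm_cong:
  assumes "\<And>i. i < n \<Longrightarrow> a i = b i"
  shows "lp_norm q n a = lp_norm q n b"
proof -
  have "a ` {..<n} = b ` {..<n}" using assms by (intro image_cong) auto
  moreover have "(\<Sum>i<n. a i powr enn2real q) = (\<Sum>i<n. b i powr enn2real q)"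
    using assms by (intro sum.cong) auto
  ultimately show ?thesis by (simp only: lp_norm_def)
qed

lemma enn2real_ge_1:
  fixes q :: ennreal assumes "1 \<le> q" "q \<noteq> \<infinity>" shows "1 \<le> enn2real q"
  using assms by (cases q) (auto simp: top_unique)

lemma lp_norm_nonneg:
  assumes "0 < n" "\<And>i. i < n \<Longrightarrow> 0 \<le> a i"
  shows "0 \<le> lp_norm q n a"
proof (cases "q = \<infinity>")
  case True
  have "0 \<le> a 0" using assms by simp
  also have "a 0 \<le> Max (a ` {..<n})" using assms by (intro Max_ge) auto
  finally show ?thesis using True by (simp add: lp_norm_def)
qed (simp add: lp_norm_def)

lemma lp_norm_mono:
  assumes "0 < n" "1 \<le> q" "\<And>i. i < n \<Longrightarrow> 0 \<le> a i" "\<And>i. i < n \<Longrightarrow> a i \<le> b i"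
  shows "lp_norm q n a \<le> lp_norm q n b"
proof (cases "q = \<infinity>")
  case True
  have "\<exists>y\<in>b ` {..<n}. x \<le> y" if "x \<in> a ` {..<n}" for x using that assms(4) by auto
  then have "\<forall>x\<in>a ` {..<n}. x \<le> Max (b ` {..<n})"
    by (metis Max_ge finite_imageI finite_lessThan order_trans)
  moreover have "a ` {..<n} \<noteq> {}" using assms(1) by auto
  ultimately show ?thesis using True by (simp add: lp_norm_def)
next
  case False
  note r = enn2real_ge_1[OF assms(2) False]
  have "(\<Sum>i<n. a i powr enn2real q) \<le> (\<Sum>i<n. b i powr enn2real q)"
    using assms r by (intro sum_mono powr_mono2) auto
  then show ?thesis using False r by (simp add: lp_norm_def powr_mono2 sum_nonneg)
qed

lemma lp_norm_scale:
  assumes "0 < n" "1 \<le> q" "0 \<le> c" "\<And>i. i < n \<Longrightarrow> 0 \<le> a i"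
  shows "lp_norm q n (\<lambda>i. c * a i) = c * lp_norm q n a"
proof (cases "q = \<infinity>")
  case True
  have "mono (\<lambda>x. c * x)" using assms(3) by (simp add: mono_def mult_left_mono)
  then have "c * Max (a ` {..<n}) = Max ((\<lambda>x. c * x) ` a ` {..<n})"
    using assms(1) by (intro mono_Max_commute) auto
  then show ?thesis using True by (simp add: lp_norm_def image_image)
next
  case False
  note r = enn2real_ge_1[OF assms(2) False]
  have "(\<Sum>i<n. (c * a i) powr enn2real q) = c powr enn2real q * (\<Sum>i<n. a i powr enn2real q)"
    using assms by (simp add: powr_mult sum_distrib_left)
  then show ?thesis using False r assms by (simp add: lp_norm_def powr_mult sum_nonneg powr_powr)
qed

lemma lp_norm_single:
  assumes "1 \<le> q" "0 \<le> a 0"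
  shows "lp_norm q 1 a = a 0"
  using assms enn2real_ge_1[of q] by (auto simp: lp_norm_def powr_powr lessThan_Suc)

lemma lp_norm_ge_entry:
  assumes "1 \<le> q" "\<And>i. i < n \<Longrightarrow> 0 \<le> a i" "k < n"
  shows "a k \<le> lp_norm q n a"
proof (cases "q = \<infinity>")
  case True
  then show ?thesis using assms by (auto simp: lp_norm_def)
next
  case False
  note r = enn2real_ge_1[OF assms(1) False]
  have "a k powr enn2real q \<le> (\<Sum>i<n. a i powr enn2real q)"
    using assms by (intro member_le_sum) auto
  then have "(a k powr enn2real q) powr (1 / enn2real q) \<le> lp_norm q n a"
    using False r by (simp add: lp_norm_def powr_mono2)
  then show ?thesis using r assms by (simp add: powr_powr)
qed

text \<open>
  Membership in the unit ball needs no root, so Minkowski's and Hoelder's inequalities are proved there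
  and transported by homogeneity.
\<close>

lemma lp_norm_le_1_iff:
  assumes "0 < n" "1 \<le> q"
  shows "lp_norm q n a \<le> 1 \<longleftrightarrow>
    (if q = \<infinity> then \<forall>i<n. a i \<le> 1 else (\<Sum>i<n. a i powr enn2real q) \<le> 1)"
proof (cases "q = \<infinity>")
  case True
  have "a ` {..<n} \<noteq> {}" using assms(1) by auto
  with True show ?thesis by (auto simp: lp_norm_def)
next
  case False
  note r = enn2real_ge_1[OF assms(2) False]
  have "s powr (1 / enn2real q) \<le> 1 \<longleftrightarrow> s \<le> 1" if "0 \<le> s" for s :: real
    using powr_le1[of "1 / enn2real q" s] gr_one_powr[of s "1 / enn2real q"] that r
    by (cases "s \<le> 1") (auto simp del: gr_one_powr)
  then show ?thesis using False by (simp add: lp_norm_def sum_nonneg)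
qed

lemma lp_norm_normalise:
  assumes "0 < n" "1 \<le> q" "\<And>i. i < n \<Longrightarrow> 0 \<le> a i" "lp_norm q n a \<noteq> 0"
  shows "lp_norm q n (\<lambda>i. a i / lp_norm q n a) = 1"
  using lp_norm_scale[OF assms(1,2), of "1 / lp_norm q n a" a] assms lp_norm_nonneg[of n a q]
  by simp

text \<open>
  The entries of a sequence may vanish, so convexity is needed on the closed half-line; at an endpoint
  \<open>0\<close> it reduces to \<open>s powr r \<le> s\<close> for \<open>0 \<le> s \<le> 1\<close>.
\<close>

lemma powr_convex_nonneg:
  fixes a b s t r :: real
  assumes "1 \<le> r" "0 \<le> a" "0 \<le> b" "0 \<le> s" "0 \<le> t" "s + t = 1"
  shows "(s * a + t * b) powr r \<le> s * a powr r + t * b powr r"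
proof -
  have shrink: "(s * a) powr r \<le> s * a powr r" if "0 \<le> s" "s \<le> 1" "0 \<le> a" for s a :: real
  proof -
    have "s powr r \<le> s" using powr_mono'[of 1 r s] that assms(1) by (cases "s = 0") auto
    then show ?thesis using that by (simp add: powr_mult mult_right_mono)
  qed
  consider "a = 0" | "b = 0" | "0 < a" "0 < b" using assms by fastforce
  then show ?thesis
  proof cases
    case 3
    then show ?thesis
      using convex_onD[OF powr_convex[OF assms(1)], of t a b] assms
      by (simp add: eq_diff_eq[symmetric] add.commute)
  qed (use shrink[of s a] shrink[of t b] assms in auto)
qed

text \<open>
  Minkowski's inequality: \<open>(a + b) / (s + t)\<close>, with \<open>s\<close> and \<open>t\<close> the norms of \<open>a\<close> and \<open>b\<close>, is a convex
  combination of \<open>a / s\<close> and \<open>b / t\<close>, and the unit ball is convex.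
\<close>

lemma lp_norm_triangle:
  assumes n: "0 < n" and q: "1 \<le> q"
    and a: "\<And>i. i < n \<Longrightarrow> 0 \<le> a i" and b: "\<And>i. i < n \<Longrightarrow> 0 \<le> b i"
  shows "lp_norm q n (\<lambda>i. a i + b i) \<le> lp_norm q n a + lp_norm q n b"
proof -
  define s where "s = lp_norm q n a"
  define t where "t = lp_norm q n b"
  have zero: "a i = 0" if "lp_norm q n a = 0" "i < n" "\<And>i. i < n \<Longrightarrow> 0 \<le> a i" for a i
    using lp_norm_ge_entry[OF q, of n a i] that by fastforce
  have st0: "0 \<le> s" "0 \<le> t" using lp_norm_nonneg n a b by (auto simp: s_def t_def)
  consider "s = 0" | "t = 0" | "0 < s" "0 < t" using st0 by fastforce
  then show ?thesis
  proof cases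
    case 1
    then have "lp_norm q n (\<lambda>i. a i + b i) = lp_norm q n b"
      using zero[of a] a by (intro lp_norm_cong) (auto simp: s_def)
    then show ?thesis using st0 by (simp add: s_def)
  next
    case 2
    then have "lp_norm q n (\<lambda>i. a i + b i) = lp_norm q n a"
      using zero[of b] b by (intro lp_norm_cong) (auto simp: t_def)
    then show ?thesis using st0 by (simp add: t_def)
  next
    case 3
    define l where "l = s / (s + t)"
    define k where "k = t / (s + t)"
    have lk: "0 \<le> l" "0 \<le> k" "l + k = 1"
      using 3 by (auto simp: l_def k_def add_divide_distrib[symmetric])
    have na: "lp_norm q n (\<lambda>i. a i / s) \<le> 1" and nb: "lp_norm q n (\<lambda>i. b i / t) \<le> 1"
      using lp_norm_normalise[OF n q a] lp_norm_normalise[OF n q b] 3 by (auto simp: s_def t_def)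
    have "lp_norm q n (\<lambda>i. l * (a i / s) + k * (b i / t)) \<le> 1"
    proof (cases "q = \<infinity>")
      case True
      have "l * (a i / s) + k * (b i / t) \<le> l * 1 + k * 1" if "i < n" for i
        using na nb that lk unfolding lp_norm_le_1_iff[OF n q] if_P[OF True]
        by (intro add_mono mult_left_mono) auto
      then show ?thesis using lk unfolding lp_norm_le_1_iff[OF n q] if_P[OF True] by auto
    next
      case False
      define r where "r = enn2real q"
      have r: "1 \<le> r" using enn2real_ge_1[OF q False] by (simp add: r_def)
      have "(\<Sum>i<n. (l * (a i / s) + k * (b i / t)) powr r)
          \<le> (\<Sum>i<n. l * (a i / s) powr r + k * (b i / t) powr r)"
        using 3 a b lk r by (intro sum_mono powr_convex_nonneg) auto
      also have "\<dots> = l * (\<Sum>i<n. (a i / s) powr r) + k * (\<Sum>i<n. (b i / t) powr r)"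
        by (simp add: sum.distrib sum_distrib_left)
      also have "\<dots> \<le> l * 1 + k * 1"
        using na nb False lk by (intro add_mono mult_left_mono) (auto simp: lp_norm_le_1_iff[OF n q] r_def)
      finally show ?thesis using False lk by (auto simp: lp_norm_le_1_iff[OF n q] r_def)
    qed
    also have "(\<lambda>i. l * (a i / s) + k * (b i / t)) = (\<lambda>i. (1 / (s + t)) * (a i + b i))"
      using 3 by (auto simp: l_def k_def add_divide_distrib)
    also have "lp_norm q n \<dots> = (1 / (s + t)) * lp_norm q n (\<lambda>i. a i + b i)"
      using 3 a b by (intro lp_norm_scale[OF n q]) auto
    finally show ?thesis using 3 by (simp add: divide_le_eq s_def t_def)
  qed
qed

lemma tendsto_Max_image:
  fixes a :: "'b \<Rightarrow> 'i \<Rightarrow> real"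
  assumes "finite A" "A \<noteq> {}" "\<And>i. i \<in> A \<Longrightarrow> ((\<lambda>k. a k i) \<longlongrightarrow> l i) F"
  shows "((\<lambda>k. Max (a k ` A)) \<longlongrightarrow> Max (l ` A)) F"
  using assms by (induction A rule: finite_ne_induct) (auto intro!: tendsto_max)

lemma tendsto_lp_norm:
  assumes n: "0 < n" and q: "1 \<le> q"
    and nonneg: "\<And>k i. i < n \<Longrightarrow> 0 \<le> a k i"
    and lim: "\<And>i. i < n \<Longrightarrow> ((\<lambda>k. a k i) \<longlongrightarrow> l i) F"
  shows "((\<lambda>k. lp_norm q n (a k)) \<longlongrightarrow> lp_norm q n l) F"
proof (cases "q = \<infinity>")
  case True
  have "{..<n} \<noteq> {}" using n by auto
  with True lim show ?thesis by (auto simp: lp_norm_def intro!: tendsto_Max_image)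
next
  case False
  note r = enn2real_ge_1[OF q False]
  have "((\<lambda>k. (\<Sum>i<n. a k i powr enn2real q) powr (1 / enn2real q))
      \<longlongrightarrow> (\<Sum>i<n. l i powr enn2real q) powr (1 / enn2real q)) F"
    using r by (intro tendsto_powr' tendsto_sum lim tendsto_const) (auto simp: nonneg sum_nonneg)
  then show ?thesis using False by (simp add: lp_norm_def)
qed

text \<open>
  The weighted inequality of arithmetic and geometric means, from convexity of the exponential.
\<close>

lemma prod_powr_le_weighted_sum:
  fixes x w :: "'i \<Rightarrow> real"
  assumes "finite J" "J \<noteq> {}" "\<And>j. j \<in> J \<Longrightarrow> 0 \<le> x j" "\<And>j. j \<in> J \<Longrightarrow> 0 < w j" "sum w J = 1"
  shows "(\<Prod>j\<in>J. x j powr w j) \<le> (\<Sum>j\<in>J. w j * x j)"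
proof (cases "\<exists>j\<in>J. x j = 0")
  case True
  then have "(\<Prod>j\<in>J. x j powr w j) = 0" using assms(1) by (auto intro!: prod_zero)
  moreover have "0 \<le> (\<Sum>j\<in>J. w j * x j)"
    using assms(3,4) by (intro sum_nonneg mult_nonneg_nonneg) (auto simp: less_imp_le)
  ultimately show ?thesis by linarith
next
  case False
  then have pos: "0 < x j" if "j \<in> J" for j using assms(3) that by fastforce
  have "exp (\<Sum>j\<in>J. w j *\<^sub>R ln (x j)) \<le> (\<Sum>j\<in>J. w j * exp (ln (x j)))"
    using assms by (intro convex_on_sum[OF _ _ exp_convex]) (auto simp: less_imp_le)
  also have "(\<Sum>j\<in>J. w j * exp (ln (x j))) = (\<Sum>j\<in>J. w j * x j)" using pos by simp
  also have "exp (\<Sum>j\<in>J. w j *\<^sub>R ln (x j)) = (\<Prod>j\<in>J. x j powr w j)"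
    unfolding exp_sum[OF assms(1)] using pos
    by (intro prod.cong) (auto simp: powr_def dest: pos)
  finally show ?thesis .
qed

text \<open>
  Hoelder's inequality on the unit balls. Factors with infinite exponent have entries at most \<open>1\<close> and
  can be dropped. For the others the weights \<open>p / p\<^sub>j\<close> add up to \<open>1\<close>, and the weighted mean inequality
  bounds \<open>(\<Prod>\<^sub>j b\<^sub>j)\<^sup>p = \<Prod>\<^sub>j (b\<^sub>j powr p\<^sub>j) powr (p / p\<^sub>j)\<close> entry by entry.
\<close>

lemma lp_norm_prod_le_1:
  fixes ps :: "'m::finite \<Rightarrow> ennreal"
  assumes n: "0 < n" and p: "1 \<le> p" and ps: "\<And>j. 1 \<le> ps j"
    and conj: "1 / p = (\<Sum>j\<in>UNIV. 1 / ps j)"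
    and b: "\<And>j i. i < n \<Longrightarrow> 0 \<le> b j i" and b1: "\<And>j. lp_norm (ps j) n (b j) \<le> 1"
  shows "lp_norm p n (\<lambda>i. \<Prod>j\<in>UNIV. b j i) \<le> 1"
proof (cases "p = \<infinity>")
  case True
  have le1: "b j i \<le> 1" if "i < n" for i j
    using lp_norm_ge_entry[OF ps, of n "b j" i j] b b1[of j] that by fastforce
  show ?thesis using b le1 unfolding lp_norm_le_1_iff[OF n p] if_P[OF True]
    by (auto intro!: prod_le_1)
next
  case False
  define J where "J = {j. ps j \<noteq> \<infinity>}"
  define r where "r j = enn2real (ps j)" for j
  define w where "w j = enn2real p / r j" for j
  have p1: "1 \<le> enn2real p" using enn2real_ge_1[OF p False] .
  have r1: "1 \<le> r j" if "j \<in> J" for j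
    using enn2real_ge_1[OF ps] that by (auto simp: J_def r_def)
  have le1: "b j i \<le> 1" if "i < n" for i j
    using lp_norm_ge_entry[OF ps, of n "b j" i j] b b1[of j] that by fastforce
  have psr: "ps j = ennreal (r j)" if "j \<in> J" for j
    using that by (auto simp: J_def r_def less_top[symmetric])
  have "1 / ennreal (enn2real p) = 1 / p" using False by (simp add: less_top[symmetric])
  then have "ennreal (1 / enn2real p) = 1 / p"
    using p1 divide_ennreal[of 1 "enn2real p"] by simp
  also have "\<dots> = (\<Sum>j\<in>J. 1 / ps j)"
    unfolding conj by (intro sum.mono_neutral_right) (auto simp: J_def)
  also have "\<dots> = (\<Sum>j\<in>J. ennreal (1 / r j))"
  proof (intro sum.cong refl)
    fix j assume j: "j \<in> J"
    show "1 / ps j = ennreal (1 / r j)"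
      using r1[OF j] divide_ennreal[of 1 "r j"] psr[OF j] by simp
  qed
  also have "\<dots> = ennreal (\<Sum>j\<in>J. 1 / r j)" using r1 by (intro sum_ennreal) (auto intro: order_trans[of 0 1])
  finally have inv: "1 / enn2real p = (\<Sum>j\<in>J. 1 / r j)"
  proof (subst (asm) ennreal_inj)
    show "0 \<le> (\<Sum>j\<in>J. 1 / r j)" using r1 by (force intro!: sum_nonneg)
  qed (use p1 in auto)
  have "sum w J = enn2real p * (\<Sum>j\<in>J. 1 / r j)"
    by (simp add: w_def sum_distrib_left)
  then have w1: "sum w J = 1" using p1 by (simp flip: inv)
  then have J0: "J \<noteq> {}" by auto
  have w0: "0 < w j" if "j \<in> J" for j using r1[OF that] p1 by (simp add: w_def)
  have entry: "(\<Prod>j\<in>UNIV. b j i) powr enn2real p \<le> (\<Sum>j\<in>J. w j * b j i powr r j)" if i: "i < n" for i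
  proof -
    have "(\<Prod>j\<in>UNIV. b j i) = (\<Prod>j\<in>J. b j i) * (\<Prod>j\<in>-J. b j i)"
      using prod.subset_diff[of J UNIV "\<lambda>j. b j i"] by (simp add: Compl_eq_Diff_UNIV mult.commute)
    also have "\<dots> \<le> (\<Prod>j\<in>J. b j i) * 1"
      using b le1 i by (intro mult_left_mono prod_le_1 prod_nonneg) auto
    finally have "(\<Prod>j\<in>UNIV. b j i) powr enn2real p \<le> (\<Prod>j\<in>J. b j i) powr enn2real p"
      using b i p1 by (intro powr_mono2) (auto intro!: prod_nonneg)
    also have "\<dots> = (\<Prod>j\<in>J. (b j i powr r j) powr w j)"
    proof -
      have "r j * w j = enn2real p" if "j \<in> J" for j using r1[OF that] by (simp add: w_def)
      then show ?thesis using b i by (simp add: prod_powr_distrib powr_powr)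
    qed
    also have "\<dots> \<le> (\<Sum>j\<in>J. w j * b j i powr r j)"
      using w0 w1 J0 by (intro prod_powr_le_weighted_sum) auto
    finally show ?thesis .
  qed
  have "(\<Sum>i<n. (\<Prod>j\<in>UNIV. b j i) powr enn2real p) \<le> (\<Sum>i<n. \<Sum>j\<in>J. w j * b j i powr r j)"
    using entry by (intro sum_mono) auto
  also have "\<dots> = (\<Sum>j\<in>J. w j * (\<Sum>i<n. b j i powr r j))"
    by (subst sum.swap) (simp add: sum_distrib_left)
  also have "\<dots> \<le> (\<Sum>j\<in>J. w j * 1)"
  proof (intro sum_mono mult_left_mono)
    fix j assume j: "j \<in> J"
    show "(\<Sum>i<n. b j i powr r j) \<le> 1"
      using b1[of j] j by (auto simp: lp_norm_le_1_iff[OF n ps] J_def r_def)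
    show "0 \<le> w j" using w0[OF j] by simp
  qed
  finally show ?thesis using w1 False by (simp add: lp_norm_le_1_iff[OF n p])
qed

lemma lp_norm_Holder:
  fixes ps :: "'m::finite \<Rightarrow> ennreal"
  assumes n: "0 < n" and p: "1 \<le> p" and ps: "\<And>j. 1 \<le> ps j"
    and conj: "1 / p = (\<Sum>j\<in>UNIV. 1 / ps j)"
    and a: "\<And>j i. i < n \<Longrightarrow> 0 \<le> a j i"
  shows "lp_norm p n (\<lambda>i. \<Prod>j\<in>UNIV. a j i) \<le> (\<Prod>j\<in>UNIV. lp_norm (ps j) n (a j))"
proof (cases "\<exists>j. lp_norm (ps j) n (a j) = 0")
  case True
  then obtain j where j: "lp_norm (ps j) n (a j) = 0" by blast
  have "a j i = 0" if "i < n" for i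
    using lp_norm_ge_entry[OF ps, of n "a j" i j] a[OF that, of j] a j that by auto
  then have "lp_norm p n (\<lambda>i. \<Prod>j\<in>UNIV. a j i) = lp_norm p n (\<lambda>i. 0 * 1)"
    by (intro lp_norm_cong) (auto intro!: prod_zero)
  also have "\<dots> = 0" using lp_norm_scale[OF n p, of 0 "\<lambda>_. 1"] by simp
  finally show ?thesis using a n by (auto intro!: prod_nonneg lp_norm_nonneg)
next
  case False
  define N where "N j = lp_norm (ps j) n (a j)" for j
  have N: "0 < N j" for j
    using False lp_norm_nonneg[OF n, of "a j" "ps j"] a unfolding N_def by (metis order_less_le)
  have PN: "0 < (\<Prod>j\<in>UNIV. N j)" using N by (simp add: prod_pos)
  have "lp_norm p n (\<lambda>i. \<Prod>j\<in>UNIV. a j i / N j) \<le> 1"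
  proof (intro lp_norm_prod_le_1[OF n p ps conj])
    show "lp_norm (ps j) n (\<lambda>i. a j i / N j) \<le> 1" for j
      using lp_norm_normalise[OF n ps, of "a j"] a False by (simp add: N_def)
  qed (use a N in \<open>auto intro: divide_nonneg_pos\<close>)
  also have "(\<lambda>i. \<Prod>j\<in>UNIV. a j i / N j) = (\<lambda>i. (1 / (\<Prod>j\<in>UNIV. N j)) * (\<Prod>j\<in>UNIV. a j i))"
    by (simp add: prod_dividef)
  also have "lp_norm p n \<dots> = (1 / (\<Prod>j\<in>UNIV. N j)) * lp_norm p n (\<lambda>i. \<Prod>j\<in>UNIV. a j i)"
    using PN a by (intro lp_norm_scale[OF n p]) (auto intro!: prod_nonneg)
  finally show ?thesis using PN by (simp add: divide_le_eq N_def)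
qed

section \<open>Normed spaces with an explicit carrier\<close>

locale scalar_field =
  fixes K :: "complex set"
  assumes scalars: "K = \<real> \<or> K = UNIV"
begin

lemma scalar_closed [simp]:
  "0 \<in> K" "1 \<in> K" "of_real r \<in> K"
  "a \<in> K \<Longrightarrow> - a \<in> K" "a \<in> K \<Longrightarrow> b \<in> K \<Longrightarrow> a + b \<in> K" "a \<in> K \<Longrightarrow> b \<in> K \<Longrightarrow> a * b \<in> K"
  "a \<in> K \<Longrightarrow> inverse a \<in> K" "a \<in> K \<Longrightarrow> b \<in> K \<Longrightarrow> a / b \<in> K"
  using scalars by auto

lemma prod_scalar_closed: "(\<And>j. j \<in> J \<Longrightarrow> f j \<in> K) \<Longrightarrow> (\<Prod>j\<in>J. f j) \<in> K"
  by (induction J rule: infinite_finite_induct) auto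

lemma scalar_ring_simps [simp]:
  "carrier (scalar_ring K) = K" "\<one>\<^bsub>scalar_ring K\<^esub> = 1" "\<zero>\<^bsub>scalar_ring K\<^esub> = 0"
  "a \<otimes>\<^bsub>scalar_ring K\<^esub> b = a * b" "a \<oplus>\<^bsub>scalar_ring K\<^esub> b = a + b"
  by (simp_all add: scalar_ring_def)

lemma cring_scalar_ring: "cring (scalar_ring K)"
proof (intro cringI abelian_groupI comm_monoidI)
  show "\<exists>y\<in>carrier (scalar_ring K). y \<oplus>\<^bsub>scalar_ring K\<^esub> x = \<zero>\<^bsub>scalar_ring K\<^esub>"
    if "x \<in> carrier (scalar_ring K)" for x
    using that by (intro bexI[of _ "- x"]) auto
qed (auto simp: algebra_simps)

lemma minus_one_scalar_ring: "\<ominus>\<^bsub>scalar_ring K\<^esub> 1 = - 1"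
proof -
  interpret R: cring "scalar_ring K" by (rule cring_scalar_ring)
  have "- 1 = \<ominus>\<^bsub>scalar_ring K\<^esub> 1" by (rule R.minus_equality[symmetric]) auto
  then show ?thesis ..
qed

end

locale normed_module = scalar_field K for K +
  fixes X :: "('a, 'z) nspace_scheme"
  assumes normed: "normed_space K X"
begin

sublocale M: module "scalar_ring K" X
  using normed by (simp add: normed_space_def)

lemma closed [simp, intro]:
  "\<zero>\<^bsub>X\<^esub> \<in> carrier X"
  "x \<in> carrier X \<Longrightarrow> y \<in> carrier X \<Longrightarrow> x \<oplus>\<^bsub>X\<^esub> y \<in> carrier X"
  "x \<in> carrier X \<Longrightarrow> y \<in> carrier X \<Longrightarrow> x \<ominus>\<^bsub>X\<^esub> y \<in> carrier X"
  "x \<in> carrier X \<Longrightarrow> \<ominus>\<^bsub>X\<^esub> x \<in> carrier X"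
  "c \<in> K \<Longrightarrow> x \<in> carrier X \<Longrightarrow> c \<odot>\<^bsub>X\<^esub> x \<in> carrier X"
  using M.smult_closed by auto

lemma smult_simps:
  "a \<in> K \<Longrightarrow> b \<in> K \<Longrightarrow> x \<in> carrier X \<Longrightarrow> (a + b) \<odot>\<^bsub>X\<^esub> x = a \<odot>\<^bsub>X\<^esub> x \<oplus>\<^bsub>X\<^esub> b \<odot>\<^bsub>X\<^esub> x"
  "a \<in> K \<Longrightarrow> x \<in> carrier X \<Longrightarrow> y \<in> carrier X \<Longrightarrow> a \<odot>\<^bsub>X\<^esub> (x \<oplus>\<^bsub>X\<^esub> y) = a \<odot>\<^bsub>X\<^esub> x \<oplus>\<^bsub>X\<^esub> a \<odot>\<^bsub>X\<^esub> y"
  "a \<in> K \<Longrightarrow> b \<in> K \<Longrightarrow> x \<in> carrier X \<Longrightarrow> (a * b) \<odot>\<^bsub>X\<^esub> x = a \<odot>\<^bsub>X\<^esub> (b \<odot>\<^bsub>X\<^esub> x)"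
  "x \<in> carrier X \<Longrightarrow> 1 \<odot>\<^bsub>X\<^esub> x = x"
  "x \<in> carrier X \<Longrightarrow> 0 \<odot>\<^bsub>X\<^esub> x = \<zero>\<^bsub>X\<^esub>"
  "a \<in> K \<Longrightarrow> a \<odot>\<^bsub>X\<^esub> \<zero>\<^bsub>X\<^esub> = \<zero>\<^bsub>X\<^esub>"
  using M.smult_l_distr[of a b x] M.smult_r_distr[of a x y] M.smult_assoc1[of a b x]
    M.smult_one[of x] M.smult_l_null[of x] M.smult_r_null[of a] by simp_all

lemma uminus_smult: "x \<in> carrier X \<Longrightarrow> \<ominus>\<^bsub>X\<^esub> x = (- 1) \<odot>\<^bsub>X\<^esub> x"
  using M.smult_l_minus[of 1 x] by (simp add: minus_one_scalar_ring smult_simps)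

lemma minus_smult: "y \<in> carrier X \<Longrightarrow> x \<ominus>\<^bsub>X\<^esub> y = x \<oplus>\<^bsub>X\<^esub> (- 1) \<odot>\<^bsub>X\<^esub> y"
  by (simp add: a_minus_def uminus_smult)

lemma vnorm_props:
  "x \<in> carrier X \<Longrightarrow> 0 \<le> vnorm X x"
  "x \<in> carrier X \<Longrightarrow> vnorm X x = 0 \<longleftrightarrow> x = \<zero>\<^bsub>X\<^esub>"
  "x \<in> carrier X \<Longrightarrow> y \<in> carrier X \<Longrightarrow> vnorm X (x \<oplus>\<^bsub>X\<^esub> y) \<le> vnorm X x + vnorm X y"
  "c \<in> K \<Longrightarrow> x \<in> carrier X \<Longrightarrow> vnorm X (c \<odot>\<^bsub>X\<^esub> x) = cmod c * vnorm X x"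
  using normed by (auto simp: normed_space_def)

lemma vnorm_zero [simp]: "vnorm X \<zero>\<^bsub>X\<^esub> = 0"
  by (simp add: vnorm_props)

lemma vnorm_uminus: "x \<in> carrier X \<Longrightarrow> vnorm X (\<ominus>\<^bsub>X\<^esub> x) = vnorm X x"
  by (simp add: uminus_smult vnorm_props)

lemma vnorm_minus_le: "x \<in> carrier X \<Longrightarrow> y \<in> carrier X \<Longrightarrow> vnorm X (x \<ominus>\<^bsub>X\<^esub> y) \<le> vnorm X x + vnorm X y"
  using vnorm_props(3)[of x "\<ominus>\<^bsub>X\<^esub> y"] by (simp add: a_minus_def vnorm_uminus)

lemma minus_swap: "x \<in> carrier X \<Longrightarrow> y \<in> carrier X \<Longrightarrow> y \<ominus>\<^bsub>X\<^esub> x = \<ominus>\<^bsub>X\<^esub> (x \<ominus>\<^bsub>X\<^esub> y)"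
  by (simp add: a_minus_def M.M.minus_add M.M.minus_minus M.M.a_comm)

lemma vnorm_minus_commute: "x \<in> carrier X \<Longrightarrow> y \<in> carrier X \<Longrightarrow> vnorm X (x \<ominus>\<^bsub>X\<^esub> y) = vnorm X (y \<ominus>\<^bsub>X\<^esub> x)"
  using minus_swap[of x y] by (simp add: vnorm_uminus)

lemma minus_add_cancel: "x \<in> carrier X \<Longrightarrow> y \<in> carrier X \<Longrightarrow> (x \<ominus>\<^bsub>X\<^esub> y) \<oplus>\<^bsub>X\<^esub> y = x"
  by (simp add: a_minus_def M.M.a_assoc M.M.l_neg)

lemma minus_minus_cancel: "x \<in> carrier X \<Longrightarrow> y \<in> carrier X \<Longrightarrow> x \<ominus>\<^bsub>X\<^esub> (x \<ominus>\<^bsub>X\<^esub> y) = y"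
  by (simp add: a_minus_def M.M.minus_add M.M.minus_minus M.M.a_assoc[symmetric] M.M.r_neg)

lemma minus_eq_zero: "x \<in> carrier X \<Longrightarrow> y \<in> carrier X \<Longrightarrow> x \<ominus>\<^bsub>X\<^esub> y = \<zero>\<^bsub>X\<^esub> \<Longrightarrow> x = y"
  using minus_add_cancel[of x y] by simp

lemma add_minus_add:
  assumes "x \<in> carrier X" "y \<in> carrier X" "z \<in> carrier X" "w \<in> carrier X"
  shows "(x \<oplus>\<^bsub>X\<^esub> y) \<ominus>\<^bsub>X\<^esub> (z \<oplus>\<^bsub>X\<^esub> w) = (x \<ominus>\<^bsub>X\<^esub> z) \<oplus>\<^bsub>X\<^esub> (y \<ominus>\<^bsub>X\<^esub> w)"
  using assms by (simp add: a_minus_def M.M.minus_add M.M.a_ac)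

lemma smult_minus:
  assumes "c \<in> K" "x \<in> carrier X" "y \<in> carrier X"
  shows "c \<odot>\<^bsub>X\<^esub> x \<ominus>\<^bsub>X\<^esub> c \<odot>\<^bsub>X\<^esub> y = c \<odot>\<^bsub>X\<^esub> (x \<ominus>\<^bsub>X\<^esub> y)"
  using assms M.smult_r_minus[of c y] by (simp add: a_minus_def smult_simps)

lemma vnorm_minus_triangle:
  assumes "x \<in> carrier X" "y \<in> carrier X" "z \<in> carrier X"
  shows "vnorm X (x \<ominus>\<^bsub>X\<^esub> z) \<le> vnorm X (x \<ominus>\<^bsub>X\<^esub> y) + vnorm X (y \<ominus>\<^bsub>X\<^esub> z)"
proof -
  have "x \<ominus>\<^bsub>X\<^esub> z = (x \<ominus>\<^bsub>X\<^esub> y) \<oplus>\<^bsub>X\<^esub> (y \<ominus>\<^bsub>X\<^esub> z)"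
    using minus_add_cancel[OF assms(1,2)] assms by (simp add: a_minus_def M.M.a_assoc[symmetric])
  then show ?thesis using vnorm_props(3) assms by simp
qed

lemma metric_space: "Metric_space (carrier X) (vdist X)"
proof
  fix x y z
  show "0 \<le> vdist X x y" by (simp add: vdist_def vnorm_props)
  show "vdist X x y = vdist X y x" using vnorm_minus_commute[of x y] by (simp add: vdist_def)
  show "vdist X x y = 0 \<longleftrightarrow> x = y" if "x \<in> carrier X" "y \<in> carrier X"
    using that minus_eq_zero[of x y] by (auto simp: vdist_def vnorm_props a_minus_def M.M.r_neg)
  show "vdist X x z \<le> vdist X x y + vdist X y z"
    if "x \<in> carrier X" "y \<in> carrier X" "z \<in> carrier X"
    using vnorm_minus_triangle that by (simp add: vdist_def)
qed

text \<open>
  Sequences and limits in terms of the norm avoid the case distinction in \<open>vdist\<close>.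
\<close>

definition vlim :: "(nat \<Rightarrow> 'a) \<Rightarrow> 'a \<Rightarrow> bool" where
  "vlim s l \<longleftrightarrow> (\<forall>n. s n \<in> carrier X) \<and> l \<in> carrier X \<and> (\<lambda>n. vnorm X (s n \<ominus>\<^bsub>X\<^esub> l)) \<longlonglongrightarrow> 0"

definition vCauchy :: "(nat \<Rightarrow> 'a) \<Rightarrow> bool" where
  "vCauchy s \<longleftrightarrow> (\<forall>n. s n \<in> carrier X) \<and>
    (\<forall>e>0. \<exists>N. \<forall>m\<ge>N. \<forall>n\<ge>N. vnorm X (s m \<ominus>\<^bsub>X\<^esub> s n) < e)"

lemma vlim_iff: "vlim s l \<longleftrightarrow> (\<forall>n. s n \<in> carrier X) \<and> l \<in> carrier X \<and>
    (\<forall>e>0. \<exists>N. \<forall>n\<ge>N. vnorm X (s n \<ominus>\<^bsub>X\<^esub> l) < e)"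
  by (auto simp: vlim_def LIMSEQ_def vnorm_props)

lemma banach_space_iff:
  "banach_space K X \<longleftrightarrow> (\<forall>s. vCauchy s \<longrightarrow> (\<exists>l. vlim s l))"
proof -
  interpret Metric_space "carrier X" "vdist X" by (rule metric_space)
  have cau: "MCauchy s \<longleftrightarrow> vCauchy s" for s
  proof (cases "\<forall>n. s n \<in> carrier X")
    case True
    then have "vdist X (s m) (s n) = vnorm X (s m \<ominus>\<^bsub>X\<^esub> s n)" for m n by (simp add: vdist_def)
    with True show ?thesis
      unfolding MCauchy_def vCauchy_def by (simp add: image_subset_iff)
  next
    case False
    then show ?thesis unfolding MCauchy_def vCauchy_def by (auto simp: image_subset_iff)
  qed
  have lim: "limitin mtopology s l sequentially \<longleftrightarrow> vlim s l" if "\<forall>n. s n \<in> carrier X" for s l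
    unfolding limit_metric_sequentially vlim_iff using that by (auto simp: vdist_def)
  have "(\<exists>l. limitin mtopology s l sequentially) \<longleftrightarrow> (\<exists>l. vlim s l)" if "vCauchy s" for s
    using lim[of s] that by (simp add: vCauchy_def)
  then show ?thesis
    using normed unfolding banach_space_def mcomplete_def cau by simp
qed

lemma vlim_add:
  assumes "vlim s l" "vlim t r"
  shows "vlim (\<lambda>n. s n \<oplus>\<^bsub>X\<^esub> t n) (l \<oplus>\<^bsub>X\<^esub> r)"
proof -
  have c: "s n \<in> carrier X" "t n \<in> carrier X" "l \<in> carrier X" "r \<in> carrier X" for n
    using assms by (auto simp: vlim_def)
  have "(\<lambda>n. vnorm X (s n \<ominus>\<^bsub>X\<^esub> l) + vnorm X (t n \<ominus>\<^bsub>X\<^esub> r)) \<longlonglongrightarrow> 0 + 0"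
    using assms by (intro tendsto_add) (auto simp: vlim_def)
  then have "(\<lambda>n. vnorm X ((s n \<oplus>\<^bsub>X\<^esub> t n) \<ominus>\<^bsub>X\<^esub> (l \<oplus>\<^bsub>X\<^esub> r))) \<longlonglongrightarrow> 0"
    by - (rule Lim_null_comparison[where g = "\<lambda>n. vnorm X (s n \<ominus>\<^bsub>X\<^esub> l) + vnorm X (t n \<ominus>\<^bsub>X\<^esub> r)", rotated], use c in \<open>auto simp: vnorm_props add_minus_add\<close>)
  then show ?thesis using c by (simp add: vlim_def)
qed

lemma vlim_smult:
  assumes "vlim s l" "c \<in> K"
  shows "vlim (\<lambda>n. c \<odot>\<^bsub>X\<^esub> s n) (c \<odot>\<^bsub>X\<^esub> l)"
proof -
  have "(\<lambda>n. cmod c * vnorm X (s n \<ominus>\<^bsub>X\<^esub> l)) \<longlonglongrightarrow> cmod c * 0"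
    using assms by (intro tendsto_mult) (auto simp: vlim_def)
  then show ?thesis using assms by (simp add: vlim_def smult_minus vnorm_props)
qed

lemma vlim_const: "x \<in> carrier X \<Longrightarrow> vlim (\<lambda>_. x) x"
  by (simp add: vlim_def a_minus_def M.M.r_neg)

lemma vlim_unique:
  assumes "vlim s l" "vlim s r"
  shows "l = r"
proof -
  have c: "s n \<in> carrier X" "l \<in> carrier X" "r \<in> carrier X" for n
    using assms by (auto simp: vlim_def)
  have "(\<lambda>n. vnorm X (s n \<ominus>\<^bsub>X\<^esub> l) + vnorm X (s n \<ominus>\<^bsub>X\<^esub> r)) \<longlonglongrightarrow> 0 + 0"
    using assms by (intro tendsto_add) (auto simp: vlim_def)
  moreover have "vnorm X (l \<ominus>\<^bsub>X\<^esub> r) \<le> vnorm X (s n \<ominus>\<^bsub>X\<^esub> l) + vnorm X (s n \<ominus>\<^bsub>X\<^esub> r)" for n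
    using vnorm_minus_triangle[of l "s n" r] vnorm_minus_commute[of l "s n"] c by simp
  ultimately have "vnorm X (l \<ominus>\<^bsub>X\<^esub> r) \<le> 0 + 0"
    by (rule LIMSEQ_le_const[OF _ exI[of _ 0], rule_format])
  then have "vnorm X (l \<ominus>\<^bsub>X\<^esub> r) = 0" using vnorm_props(1)[of "l \<ominus>\<^bsub>X\<^esub> r"] c by auto
  then show ?thesis using c minus_eq_zero by (simp add: vnorm_props)
qed

lemma vlim_vnorm:
  assumes "vlim s l"
  shows "(\<lambda>n. vnorm X (s n)) \<longlonglongrightarrow> vnorm X l"
proof -
  have c: "s n \<in> carrier X" "l \<in> carrier X" for n
    using assms by (auto simp: vlim_def)
  have "\<bar>vnorm X (s n) - vnorm X l\<bar> \<le> vnorm X (s n \<ominus>\<^bsub>X\<^esub> l)" for n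
    using vnorm_props(3)[of "s n \<ominus>\<^bsub>X\<^esub> l" l] vnorm_props(3)[of "l \<ominus>\<^bsub>X\<^esub> s n" "s n"]
      vnorm_minus_commute[of "s n" l] c by (simp add: minus_add_cancel abs_le_iff)
  then have "(\<lambda>n. vnorm X (s n) - vnorm X l) \<longlonglongrightarrow> 0"
    by - (rule Lim_null_comparison[where g = "\<lambda>n. vnorm X (s n \<ominus>\<^bsub>X\<^esub> l)", rotated], use assms in \<open>auto simp: vlim_def\<close>)
  then show ?thesis by (simp add: LIM_zero_iff)
qed

end

lemma (in scalar_field) normed_scalar_space: "normed_space K (scalar_space K)"
proof -
  have "Module.module (scalar_ring K) (scalar_space K)"
  proof (intro moduleI cring_scalar_ring abelian_groupI)
    show "\<exists>y\<in>carrier (scalar_space K). y \<oplus>\<^bsub>scalar_space K\<^esub> x = \<zero>\<^bsub>scalar_space K\<^esub>"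
      if "x \<in> carrier (scalar_space K)" for x
      using that by (intro bexI[of _ "- x"]) (auto simp: scalar_space_def)
  qed (auto simp: scalar_space_def algebra_simps)
  then show ?thesis
    by (auto simp: normed_space_def norm_mult norm_triangle_ineq) (auto simp: scalar_space_def norm_mult norm_triangle_ineq)
qed

section \<open>Bounded linear operators and weak norms\<close>

lemma linear_opsD:
  assumes "u \<in> linear_ops K X Y"
  shows "x \<in> carrier X \<Longrightarrow> u x \<in> carrier Y"
    and "x \<in> carrier X \<Longrightarrow> y \<in> carrier X \<Longrightarrow> u (x \<oplus>\<^bsub>X\<^esub> y) = u x \<oplus>\<^bsub>Y\<^esub> u y"
    and "c \<in> K \<Longrightarrow> x \<in> carrier X \<Longrightarrow> u (c \<odot>\<^bsub>X\<^esub> x) = c \<odot>\<^bsub>Y\<^esub> u x"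
    and "\<exists>C. \<forall>x\<in>carrier X. vnorm Y (u x) \<le> C * vnorm X x"
  using assms by (auto simp: linear_ops_def)

lemma
  assumes "scalar_field K" "normed_space K X" "normed_space K Y" "u \<in> linear_ops K X Y"
  shows op_norm_nonneg: "0 \<le> op_norm X Y u"
    and vnorm_le_op_norm: "x \<in> carrier X \<Longrightarrow> vnorm Y (u x) \<le> op_norm X Y u * vnorm X x"
    and op_norm_le: "0 \<le> c \<Longrightarrow> (\<And>x. x \<in> carrier X \<Longrightarrow> vnorm Y (u x) \<le> c * vnorm X x)
      \<Longrightarrow> op_norm X Y u \<le> c"
proof -
  interpret scalar_field K by fact
  interpret X: normed_module K X by unfold_locales fact
  interpret Y: normed_module K Y by unfold_locales fact
  note uD = linear_opsD[OF assms(4)]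
  let ?B = "{x \<in> carrier X. vnorm X x \<le> 1}"
  obtain C where C: "\<And>x. x \<in> carrier X \<Longrightarrow> vnorm Y (u x) \<le> C * vnorm X x" using uD(4) by blast
  have CB: "vnorm Y (u x) \<le> \<bar>C\<bar>" if "x \<in> ?B" for x
  proof -
    have "C * vnorm X x \<le> \<bar>C\<bar> * 1"
      using that X.vnorm_props(1)[of x] by (intro mult_mono) auto
    then show ?thesis using C[of x] that by auto
  qed
  have bdd: "bdd_above ((\<lambda>x. vnorm Y (u x)) ` ?B)" using CB by (intro bdd_aboveI2) auto
  have up: "vnorm Y (u x) \<le> op_norm X Y u" if "x \<in> ?B" for x
    unfolding op_norm_def using that bdd by (rule cSUP_upper)
  have "0 \<le> vnorm Y (u \<zero>\<^bsub>X\<^esub>)" by (intro Y.vnorm_props uD) auto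
  also have "\<dots> \<le> op_norm X Y u" by (intro up) auto
  finally show "0 \<le> op_norm X Y u" .
  show "vnorm Y (u x) \<le> op_norm X Y u * vnorm X x" if x: "x \<in> carrier X"
  proof (cases "vnorm X x = 0")
    case True
    then show ?thesis using C[OF x] by simp
  next
    case False
    define r where "r = 1 / vnorm X x"
    have r: "0 < r" using False X.vnorm_props(1)[OF x] by (simp add: r_def)
    have "vnorm Y (u (of_real r \<odot>\<^bsub>X\<^esub> x)) \<le> op_norm X Y u"
      using x r False by (intro up) (auto simp: X.vnorm_props r_def norm_divide)
    then have "r * vnorm Y (u x) \<le> op_norm X Y u"
      using x r uD(1,3) by (simp add: Y.vnorm_props)
    then show ?thesis using r by (simp add: r_def field_simps split: if_splits)
  qed
  show "op_norm X Y u \<le> c" if c: "0 \<le> c" "\<And>x. x \<in> carrier X \<Longrightarrow> vnorm Y (u x) \<le> c * vnorm X x"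
    unfolding op_norm_def
  proof (intro cSUP_least)
    show "?B \<noteq> {}" using X.closed(1) by (metis (mono_tags, lifting) X.vnorm_zero empty_iff mem_Collect_eq zero_le_one)
    fix x assume x: "x \<in> ?B"
    then have "vnorm Y (u x) \<le> c * vnorm X x" using c by auto
    also have "\<dots> \<le> c * 1" using x c by (intro mult_left_mono) auto
    finally show "vnorm Y (u x) \<le> c" by simp
  qed
qed

lemma dualD:
  assumes "f \<in> dual K X"
  shows "x \<in> carrier X \<Longrightarrow> f x \<in> K"
    and "x \<in> carrier X \<Longrightarrow> y \<in> carrier X \<Longrightarrow> f (x \<oplus>\<^bsub>X\<^esub> y) = f x + f y"
    and "c \<in> K \<Longrightarrow> x \<in> carrier X \<Longrightarrow> f (c \<odot>\<^bsub>X\<^esub> x) = c * f x"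
  using linear_opsD[OF assms] by (auto simp: scalar_space_def)

context normed_module
begin

lemma dual_le_op_norm:
  assumes "f \<in> dual K X" "x \<in> carrier X"
  shows "cmod (f x) \<le> op_norm X (scalar_space K) f * vnorm X x"
  using vnorm_le_op_norm[OF scalar_field_axioms normed normed_scalar_space assms]
  by (simp add: scalar_space_def)

lemma dual_ballI:
  assumes "f \<in> carrier X \<rightarrow>\<^sub>E K"
    and "\<And>x y. x \<in> carrier X \<Longrightarrow> y \<in> carrier X \<Longrightarrow> f (x \<oplus>\<^bsub>X\<^esub> y) = f x + f y"
    and "\<And>c x. c \<in> K \<Longrightarrow> x \<in> carrier X \<Longrightarrow> f (c \<odot>\<^bsub>X\<^esub> x) = c * f x"
    and bd: "\<And>x. x \<in> carrier X \<Longrightarrow> cmod (f x) \<le> vnorm X x"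
  shows "f \<in> dual_ball K X"
proof -
  have f: "f \<in> dual K X"
    using assms by (auto simp: linear_ops_def scalar_space_def intro!: exI[of _ 1])
  have "op_norm X (scalar_space K) f \<le> 1"
    using bd by (intro op_norm_le[OF scalar_field_axioms normed normed_scalar_space f])
      (auto simp: scalar_space_def)
  with f show ?thesis by (simp add: dual_ball_def)
qed

lemma dual_ball_le:
  assumes "f \<in> dual_ball K X" "x \<in> carrier X"
  shows "cmod (f x) \<le> vnorm X x"
proof -
  have "cmod (f x) \<le> op_norm X (scalar_space K) f * vnorm X x"
    using assms by (intro dual_le_op_norm) (auto simp: dual_ball_def)
  also have "\<dots> \<le> 1 * vnorm X x"
    using assms vnorm_props(1) by (intro mult_right_mono) (auto simp: dual_ball_def)
  finally show ?thesis by simp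
qed

lemma zero_in_dual_ball: "(\<lambda>x\<in>carrier X. 0) \<in> dual_ball K X"
  by (intro dual_ballI) (auto simp: vnorm_props)

context
  fixes q :: ennreal and n :: nat and x :: "nat \<Rightarrow> 'a"
  assumes q: "1 \<le> q" and n: "0 < n" and x: "\<And>i. i < n \<Longrightarrow> x i \<in> carrier X"
begin

lemma lp_norm_le_weak_norm:
  assumes "f \<in> dual_ball K X"
  shows "lp_norm q n (\<lambda>i. cmod (f (x i))) \<le> weak_norm K X q n x"
  unfolding weak_norm_def
proof (rule cSUP_upper[OF assms])
  show "bdd_above ((\<lambda>f. lp_norm q n (\<lambda>i. cmod (f (x i)))) ` dual_ball K X)"
    using dual_ball_le x
    by (intro bdd_aboveI2[where M = "lp_norm q n (\<lambda>i. vnorm X (x i))"] lp_norm_mono[OF n q]) auto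
qed

lemma weak_norm_nonneg: "0 \<le> weak_norm K X q n x"
  by (rule order_trans[OF lp_norm_nonneg[OF n] lp_norm_le_weak_norm[OF zero_in_dual_ball]]) simp

text \<open>
  A functional of norm at most \<open>c\<close> is \<open>c\<close> times a member of the dual unit ball. This is how weak norms
  enter every estimate from above.
\<close>

lemma lp_norm_functional_le:
  assumes f: "f \<in> dual K X" and c: "0 \<le> c"
    and bd: "\<And>x. x \<in> carrier X \<Longrightarrow> cmod (f x) \<le> c * vnorm X x"
  shows "lp_norm q n (\<lambda>i. cmod (f (x i))) \<le> c * weak_norm K X q n x"
proof (cases "c = 0")
  case True
  have "lp_norm q n (\<lambda>i. cmod (f (x i))) = lp_norm q n (\<lambda>i. 0 * 1)"
    using bd x True by (intro lp_norm_cong) fastforce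
  also have "\<dots> = 0" using lp_norm_scale[OF n q, of 0 "\<lambda>_. 1"] by simp
  finally show ?thesis using True by simp
next
  case False
  define g where "g = (\<lambda>x\<in>carrier X. of_real (1 / c) * f x)"
  have "g \<in> dual_ball K X"
  proof (rule dual_ballI)
    show "cmod (g x) \<le> vnorm X x" if "x \<in> carrier X" for x
      using bd[OF that] False c that by (simp add: g_def norm_mult norm_divide field_simps)
    show "g \<in> carrier X \<rightarrow>\<^sub>E K"
      unfolding g_def using dualD(1)[OF f] by auto
  qed (use dualD[OF f] in \<open>auto simp: g_def add_divide_distrib\<close>)
  then have "lp_norm q n (\<lambda>i. cmod (g (x i))) \<le> weak_norm K X q n x"
    by (rule lp_norm_le_weak_norm)
  moreover have "lp_norm q n (\<lambda>i. cmod (f (x i))) = lp_norm q n (\<lambda>i. c * cmod (g (x i)))"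
    using False c x by (intro lp_norm_cong) (simp add: g_def norm_mult norm_divide)
  ultimately show ?thesis using c lp_norm_scale[OF n q c, of "\<lambda>i. cmod (g (x i))"]
    by (simp add: mult_left_mono)
qed

end

text \<open>
  Domination of a single tuple becomes a norm estimate through this bound.
\<close>

lemma weak_norm_single_le:
  assumes "1 \<le> q" "x 0 \<in> carrier X"
  shows "weak_norm K X q 1 x \<le> vnorm X (x 0)"
  unfolding weak_norm_def
  using zero_in_dual_ball assms dual_ball_le by (intro cSUP_least) (auto simp: lp_norm_single simp del: One_nat_def)

end

lemma weak_norm_image_le:
  assumes "scalar_field K" "normed_space K G" "normed_space K E" and u: "u \<in> linear_ops K G E"
    and q: "1 \<le> q" and n: "0 < n" and x: "\<And>i. i < n \<Longrightarrow> x i \<in> carrier G"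
  shows "weak_norm K E q n (\<lambda>i. u (x i)) \<le> op_norm G E u * weak_norm K G q n x"
proof -
  interpret scalar_field K by fact
  interpret G: normed_module K G by unfold_locales fact
  interpret E: normed_module K E by unfold_locales fact
  note u0 = op_norm_nonneg[OF assms(1-4)]
  show ?thesis unfolding weak_norm_def[of K E]
  proof (rule cSUP_least)
    show "dual_ball K E \<noteq> {}" using E.zero_in_dual_ball by blast
    fix f assume f: "f \<in> dual_ball K E"
    then have fd: "f \<in> dual K E" by (simp add: dual_ball_def)
    define g where "g = (\<lambda>x\<in>carrier G. f (u x))"
    have bd: "cmod (g x) \<le> op_norm G E u * vnorm G x" if "x \<in> carrier G" for x
      using E.dual_ball_le[OF f linear_opsD(1)[OF u that]] vnorm_le_op_norm[OF assms(1-4) that] that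
      by (simp add: g_def)
    have g: "g \<in> dual K G"
      using bd linear_opsD[OF u] dualD[OF fd]
      by (auto simp: linear_ops_def scalar_space_def g_def)
    have "lp_norm q n (\<lambda>i. cmod (f (u (x i)))) = lp_norm q n (\<lambda>i. cmod (g (x i)))"
      using x by (intro lp_norm_cong) (simp add: g_def)
    also have "\<dots> \<le> op_norm G E u * weak_norm K G q n x"
      by (rule G.lp_norm_functional_le[OF q n x g u0 bd])
    finally show "lp_norm q n (\<lambda>i. cmod (f (u (x i)))) \<le> op_norm G E u * weak_norm K G q n x" .
  qed
qed

section \<open>Positive elements of a Banach lattice\<close>

locale banach_lat = scalar_field K for K +
  fixes E :: "('a, 'z) lspace_scheme"
  assumes lattice_E: "banach_lattice K E"
begin

sublocale normed_module K E
  using lattice_E by unfold_locales (simp add: banach_lattice_def banach_space_def)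

sublocale L: Lattice.lattice "rorder E"
  rewrites "carrier (rorder E) = rpart E" and "le (rorder E) = rle E"
  using lattice_E by (simp_all add: banach_lattice_def rorder_def)

lemma rpart_closed:
  "x \<in> rpart E \<Longrightarrow> x \<in> carrier E"
  "x \<in> rpart E \<Longrightarrow> y \<in> rpart E \<Longrightarrow> x \<oplus>\<^bsub>E\<^esub> y \<in> rpart E"
  "\<zero>\<^bsub>E\<^esub> \<in> rpart E"
  "x \<in> rpart E \<Longrightarrow> of_real r \<odot>\<^bsub>E\<^esub> x \<in> rpart E"
  "x \<in> rpart E \<Longrightarrow> \<ominus>\<^bsub>E\<^esub> x \<in> rpart E"
proof -
  have sub: "submodule (rpart E) (scalar_ring \<real>) E" using lattice_E by (simp add: banach_lattice_def)
  note sg = submodule.axioms(1)[OF sub]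
  show c: "x \<in> rpart E \<Longrightarrow> x \<in> carrier E" for x using subgroup.subset[OF sg] by auto
  show "x \<in> rpart E \<Longrightarrow> y \<in> rpart E \<Longrightarrow> x \<oplus>\<^bsub>E\<^esub> y \<in> rpart E"
    using subgroup.m_closed[OF sg, of x y] by simp
  show "\<zero>\<^bsub>E\<^esub> \<in> rpart E" using subgroup.one_closed[OF sg] by simp
  show s: "x \<in> rpart E \<Longrightarrow> of_real r \<odot>\<^bsub>E\<^esub> x \<in> rpart E" for x r
    using submodule.smult_closed[OF sub, of "of_real r" x] by (simp add: scalar_ring_def)
  show "x \<in> rpart E \<Longrightarrow> \<ominus>\<^bsub>E\<^esub> x \<in> rpart E"
    using s[of x "-1"] c by (simp add: uminus_smult)
qed

lemma rle_props:
  "x \<in> rpart E \<Longrightarrow> y \<in> rpart E \<Longrightarrow> z \<in> rpart E \<Longrightarrow> rle E x y \<Longrightarrow> rle E (x \<oplus>\<^bsub>E\<^esub> z) (y \<oplus>\<^bsub>E\<^esub> z)"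
  "x \<in> rpart E \<Longrightarrow> y \<in> rpart E \<Longrightarrow> rle E x y \<Longrightarrow> 0 \<le> c \<Longrightarrow> rle E (of_real c \<odot>\<^bsub>E\<^esub> x) (of_real c \<odot>\<^bsub>E\<^esub> y)"
  "x \<in> rpart E \<Longrightarrow> y \<in> rpart E \<Longrightarrow> rle E (rabs E x) (rabs E y) \<Longrightarrow> vnorm E x \<le> vnorm E y"
  using lattice_E by (simp_all add: banach_lattice_def)

lemma pos_cone_carrier: "x \<in> pos_cone E \<Longrightarrow> x \<in> carrier E"
  by (simp add: pos_cone_def rpart_closed)

lemma rabs_props:
  assumes "x \<in> rpart E"
  shows "rabs E x \<in> rpart E" "rle E x (rabs E x)" "rle E (\<ominus>\<^bsub>E\<^esub> x) (rabs E x)"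
    and "z \<in> rpart E \<Longrightarrow> rle E x z \<Longrightarrow> rle E (\<ominus>\<^bsub>E\<^esub> x) z \<Longrightarrow> rle E (rabs E x) z"
  unfolding rabs_def
  using assms rpart_closed(5)[OF assms] L.join_closed L.join_left L.join_right L.join_le by auto

text \<open>
  Adding \<open>x \<le> |x|\<close> and \<open>-x \<le> |x|\<close> gives \<open>0 \<le> 2 |x|\<close>.
\<close>

lemma rabs_nonneg:
  assumes x: "x \<in> rpart E"
  shows "rle E \<zero>\<^bsub>E\<^esub> (rabs E x)"
proof -
  let ?r = "rabs E x"
  note m = rpart_closed(5)[OF x] and r = rabs_props(1)[OF x]
  have c: "x \<in> carrier E" "?r \<in> carrier E" "\<ominus>\<^bsub>E\<^esub> x \<in> carrier E"
    using rpart_closed(1) x m r by auto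
  have "rle E (x \<oplus>\<^bsub>E\<^esub> \<ominus>\<^bsub>E\<^esub> x) (?r \<oplus>\<^bsub>E\<^esub> \<ominus>\<^bsub>E\<^esub> x)"
    using rle_props(1) rabs_props(2)[OF x] x m r by blast
  moreover have "rle E (\<ominus>\<^bsub>E\<^esub> x \<oplus>\<^bsub>E\<^esub> ?r) (?r \<oplus>\<^bsub>E\<^esub> ?r)"
    using rle_props(1) rabs_props(3)[OF x] x m r by blast
  ultimately have "rle E \<zero>\<^bsub>E\<^esub> (?r \<oplus>\<^bsub>E\<^esub> ?r)"
    using c L.le_trans[of "\<zero>\<^bsub>E\<^esub>" "?r \<oplus>\<^bsub>E\<^esub> \<ominus>\<^bsub>E\<^esub> x" "?r \<oplus>\<^bsub>E\<^esub> ?r"] rpart_closed x m r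
    by (simp add: M.M.r_neg M.M.a_comm)
  then have "rle E (of_real (1/2) \<odot>\<^bsub>E\<^esub> \<zero>\<^bsub>E\<^esub>) (of_real (1/2) \<odot>\<^bsub>E\<^esub> (?r \<oplus>\<^bsub>E\<^esub> ?r))"
    using rpart_closed r by (intro rle_props(2)) auto
  also have "of_real (1/2) \<odot>\<^bsub>E\<^esub> (?r \<oplus>\<^bsub>E\<^esub> ?r) = (of_real (1/2) + of_real (1/2)) \<odot>\<^bsub>E\<^esub> ?r"
    unfolding smult_simps(1)[OF scalar_closed(3) scalar_closed(3) c(2)]
    by (rule smult_simps(2)[OF scalar_closed(3) c(2) c(2)])
  also have "\<dots> = ?r" using c by (simp add: smult_simps flip: of_real_add)
  finally show ?thesis using smult_simps(6)[OF scalar_closed(3), of "1/2"] by simp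
qed

lemma vnorm_rabs_le:
  assumes x: "x \<in> rpart E"
  shows "vnorm E (rabs E x) \<le> vnorm E x"
proof -
  let ?r = "rabs E x"
  note r = rabs_props(1)[OF x] and r0 = rabs_nonneg[OF x]
  note m = rpart_closed(5)[OF r]
  have c: "?r \<in> carrier E" using rpart_closed(1) r .
  have "rle E (\<zero>\<^bsub>E\<^esub> \<oplus>\<^bsub>E\<^esub> \<ominus>\<^bsub>E\<^esub> ?r) (?r \<oplus>\<^bsub>E\<^esub> \<ominus>\<^bsub>E\<^esub> ?r)"
    using rle_props(1) r0 r m rpart_closed(3) by blast
  then have "rle E (\<ominus>\<^bsub>E\<^esub> ?r) \<zero>\<^bsub>E\<^esub>" using c by (simp add: M.M.r_neg)
  then have "rle E (\<ominus>\<^bsub>E\<^esub> ?r) ?r" using L.le_trans[OF _ r0] m r rpart_closed(3) by blast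
  then have "rle E (rabs E ?r) ?r" using rabs_props(4)[OF r r] L.le_refl[OF r] by blast
  then show ?thesis using rle_props(3)[OF r x] by blast
qed

text \<open>
  The two bounds give \<open>|x| \<le> s \<le> |s|\<close>, and the norm is monotone in the modulus.
\<close>

lemma vnorm_le_of_rle:
  assumes "x \<in> rpart E" "s \<in> rpart E" "rle E x s" "rle E (\<ominus>\<^bsub>E\<^esub> x) s"
  shows "vnorm E x \<le> vnorm E s"
  using rle_props(3)[OF assms(1,2)] L.le_trans[of "rabs E x" s "rabs E s"]
    rabs_props[OF assms(1)] rabs_props[OF assms(2)] assms by blast

text \<open>
  The modulus of \<open>x + iy\<close> is the supremum of \<open>(cos t) x + (sin t) y\<close>; the angles \<open>0, \<pi>\<close> and \<open>\<plusminus>\<pi>/2\<close> show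
  that it dominates \<open>\<plusminus>x\<close> and \<open>\<plusminus>y\<close>.
\<close>

lemma real_imaginary_parts:
  assumes "z \<in> carrier E"
  obtains "z \<in> rpart E"
  | x y where "\<i> \<in> K" "x \<in> rpart E" "y \<in> rpart E" "z = x \<oplus>\<^bsub>E\<^esub> \<i> \<odot>\<^bsub>E\<^esub> y"
      "vnorm E x \<le> vnorm E z" "vnorm E y \<le> vnorm E z"
proof (cases "K = \<real>")
  case True
  then show ?thesis using lattice_E assms that(1) by (simp add: banach_lattice_def)
next
  case False
  then have "complexification E" using lattice_E by (simp add: banach_lattice_def)
  then have cx: "\<exists>!(x, y). x \<in> rpart E \<and> y \<in> rpart E \<and> z = x \<oplus>\<^bsub>E\<^esub> \<i> \<odot>\<^bsub>E\<^esub> y"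
    and lub: "\<And>x y. x \<in> rpart E \<Longrightarrow> y \<in> rpart E \<Longrightarrow> \<exists>s. is_lub (rorder E) s
          {of_real (cos t) \<odot>\<^bsub>E\<^esub> x \<oplus>\<^bsub>E\<^esub> of_real (sin t) \<odot>\<^bsub>E\<^esub> y | t :: real. True} \<and>
        vnorm E (x \<oplus>\<^bsub>E\<^esub> \<i> \<odot>\<^bsub>E\<^esub> y) = vnorm E s"
    using assms unfolding complexification_def by simp_all
  from cx obtain x y where xy: "x \<in> rpart E" "y \<in> rpart E" "z = x \<oplus>\<^bsub>E\<^esub> \<i> \<odot>\<^bsub>E\<^esub> y"
    by auto
  from lub[OF xy(1,2)] xy(3) obtain s where s: "is_lub (rorder E) s
          {of_real (cos t) \<odot>\<^bsub>E\<^esub> x \<oplus>\<^bsub>E\<^esub> of_real (sin t) \<odot>\<^bsub>E\<^esub> y | t :: real. True}"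
    and n: "vnorm E z = vnorm E s"
    by auto
  have sr: "s \<in> rpart E" using s by (simp add: least_def Upper_def rorder_def)
  have up: "rle E (of_real (cos t) \<odot>\<^bsub>E\<^esub> x \<oplus>\<^bsub>E\<^esub> of_real (sin t) \<odot>\<^bsub>E\<^esub> y) s" for t
  proof -
    have "of_real (cos t) \<odot>\<^bsub>E\<^esub> x \<oplus>\<^bsub>E\<^esub> of_real (sin t) \<odot>\<^bsub>E\<^esub> y \<in> rpart E"
      using xy rpart_closed by blast
    then show ?thesis using s by (auto simp: least_def Upper_def rorder_def)
  qed
  have c: "x \<in> carrier E" "y \<in> carrier E" using xy rpart_closed by auto
  have "vnorm E x \<le> vnorm E s"
    using up[of 0] up[of pi] xy sr c by (intro vnorm_le_of_rle) (auto simp: smult_simps uminus_smult)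
  moreover have "vnorm E y \<le> vnorm E s"
    using up[of "pi/2"] up[of "-(pi/2)"] xy sr c
    by (intro vnorm_le_of_rle) (auto simp: smult_simps uminus_smult)
  ultimately show ?thesis
    using scalars False by (intro that(2)[OF _ xy]) (simp_all add: n)
qed

text \<open>
  A real \<open>x\<close> is \<open>|x| - (|x| - x)\<close> with both terms positive, of norms at most \<open>\<parallel>x\<parallel>\<close> and \<open>2 \<parallel>x\<parallel>\<close>; hence
  the constant \<open>3\<close> for real elements and \<open>6\<close> in general. Real and complex scalars are
  treated alike because the statement speaks about a seminorm instead of a decomposition.
\<close>

lemma seminorm_le_of_pos_cone:
  fixes \<phi> :: "'a \<Rightarrow> real"
  assumes B: "0 \<le> B" "\<And>a. a \<in> pos_cone E \<Longrightarrow> \<phi> a \<le> B * vnorm E a"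
    and add: "\<And>a b. a \<in> carrier E \<Longrightarrow> b \<in> carrier E \<Longrightarrow> \<phi> (a \<oplus>\<^bsub>E\<^esub> b) \<le> \<phi> a + \<phi> b"
    and smult: "\<And>c a. c \<in> K \<Longrightarrow> a \<in> carrier E \<Longrightarrow> \<phi> (c \<odot>\<^bsub>E\<^esub> a) = cmod c * \<phi> a"
    and z: "z \<in> carrier E"
  shows "\<phi> z \<le> 6 * B * vnorm E z"
proof -
  have real: "\<phi> x \<le> 3 * B * vnorm E x" if x: "x \<in> rpart E" for x
  proof -
    let ?r = "rabs E x"
    note r = rabs_props(1)[OF x] and m = rpart_closed(5)[OF x]
    have c: "x \<in> carrier E" "?r \<in> carrier E" using rpart_closed(1) x r by auto
    have "rle E (x \<oplus>\<^bsub>E\<^esub> \<ominus>\<^bsub>E\<^esub> x) (?r \<oplus>\<^bsub>E\<^esub> \<ominus>\<^bsub>E\<^esub> x)"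
      using rle_props(1) rabs_props(2)[OF x] x m r by blast
    then have pos: "?r \<in> pos_cone E" "?r \<ominus>\<^bsub>E\<^esub> x \<in> pos_cone E"
      using c r m rabs_nonneg[OF x] rpart_closed(2)[OF r m]
      by (auto simp: pos_cone_def M.M.r_neg a_minus_def)
    have "x = ?r \<oplus>\<^bsub>E\<^esub> (- 1) \<odot>\<^bsub>E\<^esub> (?r \<ominus>\<^bsub>E\<^esub> x)"
      using minus_minus_cancel[OF c(2,1)] minus_smult[of "?r \<ominus>\<^bsub>E\<^esub> x" ?r] c by simp
    then have "\<phi> x \<le> \<phi> ?r + \<phi> (?r \<ominus>\<^bsub>E\<^esub> x)"
      using add[of ?r "(- 1) \<odot>\<^bsub>E\<^esub> (?r \<ominus>\<^bsub>E\<^esub> x)"] smult[of "- 1" "?r \<ominus>\<^bsub>E\<^esub> x"] c by simp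
    also have "\<dots> \<le> B * vnorm E ?r + B * vnorm E (?r \<ominus>\<^bsub>E\<^esub> x)"
      using B(2) pos by (intro add_mono)
    also have "\<dots> \<le> B * vnorm E x + B * (vnorm E x + vnorm E x)"
      using vnorm_rabs_le[OF x] vnorm_minus_le[OF c(2,1)] B(1) by (intro add_mono mult_left_mono) auto
    finally show ?thesis by simp
  qed
  from z show ?thesis
  proof (cases rule: real_imaginary_parts)
    case 1
    have "3 * B * vnorm E z \<le> 6 * B * vnorm E z"
      using B(1) vnorm_props(1)[OF z] by (intro mult_right_mono) auto
    then show ?thesis using real[OF 1] by linarith
  next
    case (2 x y)
    have c: "x \<in> carrier E" "y \<in> carrier E" using 2 rpart_closed by auto
    have "\<phi> z \<le> \<phi> x + \<phi> y" using add[of x "\<i> \<odot>\<^bsub>E\<^esub> y"] smult[of \<i> y] 2 c by simp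
    also have "\<dots> \<le> 3 * B * vnorm E x + 3 * B * vnorm E y" using real 2 by (intro add_mono)
    also have "\<dots> \<le> 3 * B * vnorm E z + 3 * B * vnorm E z"
      using B(1) 2 by (intro add_mono mult_left_mono) auto
    finally show ?thesis by simp
  qed
qed

end

section \<open>Multilinear operators\<close>

text \<open>
  Boundedness is split off because it is a consequence of any domination inequality.
\<close>

definition multilinear_map ::
    "complex set \<Rightarrow> ('m \<Rightarrow> ('a, 'y) nspace_scheme) \<Rightarrow> ('b, 'z) nspace_scheme
      \<Rightarrow> (('m \<Rightarrow> 'a) \<Rightarrow> 'b) \<Rightarrow> bool" where
  "multilinear_map K E X T \<longleftrightarrow> T \<in> prod_carrier E \<rightarrow>\<^sub>E carrier X \<and>
     (\<forall>x\<in>prod_carrier E. \<forall>j. \<forall>a\<in>carrier (E j). \<forall>b\<in>carrier (E j).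
        T (x(j := a \<oplus>\<^bsub>E j\<^esub> b)) = T (x(j := a)) \<oplus>\<^bsub>X\<^esub> T (x(j := b))) \<and>
     (\<forall>x\<in>prod_carrier E. \<forall>j. \<forall>c\<in>K. \<forall>a\<in>carrier (E j).
        T (x(j := c \<odot>\<^bsub>E j\<^esub> a)) = c \<odot>\<^bsub>X\<^esub> T (x(j := a)))"

lemma multilinear_ops_iff:
  "T \<in> multilinear_ops K E X \<longleftrightarrow> multilinear_map K E X T \<and>
     (\<exists>C. \<forall>x\<in>prod_carrier E. vnorm X (T x) \<le> C * (\<Prod>j\<in>UNIV. vnorm (E j) (x j)))"
  by (auto simp: multilinear_ops_def multilinear_map_def)

lemma multilinear_mapD:
  assumes "multilinear_map K E X T"
  shows "x \<in> prod_carrier E \<Longrightarrow> T x \<in> carrier X"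
    and "x \<notin> prod_carrier E \<Longrightarrow> T x = undefined"
    and "x \<in> prod_carrier E \<Longrightarrow> a \<in> carrier (E j) \<Longrightarrow> b \<in> carrier (E j) \<Longrightarrow>
      T (x(j := a \<oplus>\<^bsub>E j\<^esub> b)) = T (x(j := a)) \<oplus>\<^bsub>X\<^esub> T (x(j := b))"
    and "x \<in> prod_carrier E \<Longrightarrow> c \<in> K \<Longrightarrow> a \<in> carrier (E j) \<Longrightarrow>
      T (x(j := c \<odot>\<^bsub>E j\<^esub> a)) = c \<odot>\<^bsub>X\<^esub> T (x(j := a))"
  using assms by (auto simp: multilinear_map_def)

lemma prod_carrier_update:
  "x \<in> prod_carrier E \<Longrightarrow> a \<in> carrier (E j) \<Longrightarrow> x(j := a) \<in> prod_carrier E"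
  by (simp add: prod_carrier_def)

lemma prod_carrierD: "x \<in> prod_carrier E \<Longrightarrow> x j \<in> carrier (E j)"
  by (simp add: prod_carrier_def)

lemma multilinear_map_restrictI:
  assumes "\<And>x. x \<in> prod_carrier E \<Longrightarrow> S x \<in> carrier X"
    and "\<And>x j a b. x \<in> prod_carrier E \<Longrightarrow> a \<in> carrier (E j) \<Longrightarrow> b \<in> carrier (E j) \<Longrightarrow>
      a \<oplus>\<^bsub>E j\<^esub> b \<in> carrier (E j) \<Longrightarrow>
      S (x(j := a \<oplus>\<^bsub>E j\<^esub> b)) = S (x(j := a)) \<oplus>\<^bsub>X\<^esub> S (x(j := b))"
    and "\<And>x j c a. x \<in> prod_carrier E \<Longrightarrow> c \<in> K \<Longrightarrow> a \<in> carrier (E j) \<Longrightarrow>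
      c \<odot>\<^bsub>E j\<^esub> a \<in> carrier (E j) \<Longrightarrow>
      S (x(j := c \<odot>\<^bsub>E j\<^esub> a)) = c \<odot>\<^bsub>X\<^esub> S (x(j := a))"
    and "scalar_field K" "\<And>j. normed_space K (E j)"
  shows "multilinear_map K E X (restrict S (prod_carrier E))"
proof -
  interpret scalar_field K by fact
  have n: "normed_module K (E j)" for j using assms by unfold_locales
  have cl: "a \<oplus>\<^bsub>E j\<^esub> b \<in> carrier (E j)" if "a \<in> carrier (E j)" "b \<in> carrier (E j)" for a b j
    using normed_module.closed(2)[OF n] that by blast
  have sl: "c \<odot>\<^bsub>E j\<^esub> a \<in> carrier (E j)" if "a \<in> carrier (E j)" "c \<in> K" for a c j
    using normed_module.closed(5)[OF n] that by blast
  show ?thesis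
    unfolding multilinear_map_def using assms(1-3) cl sl
    by (simp add: prod_carrier_update restrict_PiE_iff)
qed

locale multi_spaces = scalar_field K for K +
  fixes E :: "'m::finite \<Rightarrow> ('a, 'y) nspace_scheme" and X :: "('b, 'z) nspace_scheme"
  assumes normed_factors: "\<And>j. normed_space K (E j)" and normed_target: "normed_space K X"
begin

sublocale E: normed_module K "E j" for j
  using normed_factors by unfold_locales

sublocale X: normed_module K X
  using normed_target by unfold_locales

lemma prod_vnorm_nonneg: "x \<in> prod_carrier E \<Longrightarrow> 0 \<le> (\<Prod>j\<in>UNIV. vnorm (E j) (x j))"
  by (intro prod_nonneg) (auto simp: E.vnorm_props prod_carrier_def)

lemma zero_multilinear: "(\<lambda>x\<in>prod_carrier E. \<zero>\<^bsub>X\<^esub>) \<in> multilinear_ops K E X"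
  unfolding multilinear_ops_iff
  by (auto intro!: multilinear_map_restrictI normed_factors scalar_field_axioms exI[of _ 0]
      simp: X.smult_simps)

lemma add_multilinear:
  assumes S: "multilinear_map K E X S" and T: "multilinear_map K E X T"
  shows "multilinear_map K E X (\<lambda>x\<in>prod_carrier E. S x \<oplus>\<^bsub>X\<^esub> T x)"
  by (intro multilinear_map_restrictI normed_factors scalar_field_axioms)
    (auto simp: multilinear_mapD(1,3,4)[OF S] multilinear_mapD(1,3,4)[OF T] prod_carrier_update X.smult_simps X.M.M.a_ac)

lemma smult_multilinear:
  assumes T: "multilinear_map K E X T" and c: "c \<in> K"
  shows "multilinear_map K E X (\<lambda>x\<in>prod_carrier E. c \<odot>\<^bsub>X\<^esub> T x)"
proof (intro multilinear_map_restrictI normed_factors scalar_field_axioms)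
  show "c \<odot>\<^bsub>X\<^esub> T (x(j := d \<odot>\<^bsub>E j\<^esub> a)) = d \<odot>\<^bsub>X\<^esub> (c \<odot>\<^bsub>X\<^esub> T (x(j := a)))"
    if "x \<in> prod_carrier E" "d \<in> K" "a \<in> carrier (E j)" for x j d a
  proof -
    have "T (x(j := a)) \<in> carrier X" using that by (simp add: multilinear_mapD(1)[OF T] prod_carrier_update)
    then show ?thesis using that c
      by (simp add: multilinear_mapD(4)[OF T] X.smult_simps(3)[symmetric] mult.commute)
  qed
qed (use c in \<open>auto simp: multilinear_mapD(1,3,4)[OF T] prod_carrier_update X.smult_simps\<close>)

lemma add_multilinear_ops:
  assumes S: "S \<in> multilinear_ops K E X" and T: "T \<in> multilinear_ops K E X"
  shows "(\<lambda>x\<in>prod_carrier E. S x \<oplus>\<^bsub>X\<^esub> T x) \<in> multilinear_ops K E X"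
proof -
  obtain C D where CD: "\<And>x. x \<in> prod_carrier E \<Longrightarrow> vnorm X (S x) \<le> C * (\<Prod>j\<in>UNIV. vnorm (E j) (x j))"
    "\<And>x. x \<in> prod_carrier E \<Longrightarrow> vnorm X (T x) \<le> D * (\<Prod>j\<in>UNIV. vnorm (E j) (x j))"
    using S T unfolding multilinear_ops_iff by blast
  note m = S[unfolded multilinear_ops_iff, THEN conjunct1] T[unfolded multilinear_ops_iff, THEN conjunct1]
  have "vnorm X (S x \<oplus>\<^bsub>X\<^esub> T x) \<le> (C + D) * (\<Prod>j\<in>UNIV. vnorm (E j) (x j))" if "x \<in> prod_carrier E" for x
    using CD[OF that] X.vnorm_props(3)[OF multilinear_mapD(1)[OF m(1) that] multilinear_mapD(1)[OF m(2) that]]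
    by (simp add: distrib_right)
  then show ?thesis using add_multilinear[OF m] unfolding multilinear_ops_iff by auto
qed

lemma smult_multilinear_ops:
  assumes T: "T \<in> multilinear_ops K E X" and c: "c \<in> K"
  shows "(\<lambda>x\<in>prod_carrier E. c \<odot>\<^bsub>X\<^esub> T x) \<in> multilinear_ops K E X"
proof -
  obtain C where C: "\<And>x. x \<in> prod_carrier E \<Longrightarrow> vnorm X (T x) \<le> C * (\<Prod>j\<in>UNIV. vnorm (E j) (x j))"
    using T unfolding multilinear_ops_iff by blast
  note m = T[unfolded multilinear_ops_iff, THEN conjunct1]
  have "vnorm X (c \<odot>\<^bsub>X\<^esub> T x) \<le> (cmod c * C) * (\<Prod>j\<in>UNIV. vnorm (E j) (x j))" if "x \<in> prod_carrier E" for x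
    using mult_left_mono[OF C[OF that] norm_ge_zero[of c]] c
    by (simp add: multilinear_mapD(1)[OF m that] X.vnorm_props mult.assoc)
  then show ?thesis using smult_multilinear[OF m c] unfolding multilinear_ops_iff by auto
qed

lemma multilinear_space_simps:
  "carrier (multilinear_space K E X) = multilinear_ops K E X"
  "\<zero>\<^bsub>multilinear_space K E X\<^esub> = (\<lambda>x\<in>prod_carrier E. \<zero>\<^bsub>X\<^esub>)"
  "S \<oplus>\<^bsub>multilinear_space K E X\<^esub> T = (\<lambda>x\<in>prod_carrier E. S x \<oplus>\<^bsub>X\<^esub> T x)"
  "c \<odot>\<^bsub>multilinear_space K E X\<^esub> T = (\<lambda>x\<in>prod_carrier E. c \<odot>\<^bsub>X\<^esub> T x)"
  by (simp_all add: multilinear_space_def)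

lemma multilinear_ops_eqI:
  assumes "S \<in> multilinear_ops K E X" "T \<in> multilinear_ops K E X"
    and "\<And>x. x \<in> prod_carrier E \<Longrightarrow> S x = T x"
  shows "S = T"
  using assms by (auto simp: multilinear_ops_def intro: PiE_ext)

lemma multilinear_ops_closed: "T \<in> multilinear_ops K E X \<Longrightarrow> x \<in> prod_carrier E \<Longrightarrow> T x \<in> carrier X"
  by (auto simp: multilinear_ops_def)

lemma module_multilinear_space: "Module.module (scalar_ring K) (multilinear_space K E X)"
proof (intro moduleI cring_scalar_ring abelian_groupI; unfold multilinear_space_simps scalar_ring_simps)
  fix S T U assume T: "T \<in> multilinear_ops K E X"
  show "\<exists>S\<in>multilinear_ops K E X. (\<lambda>x\<in>prod_carrier E. S x \<oplus>\<^bsub>X\<^esub> T x) = (\<lambda>x\<in>prod_carrier E. \<zero>\<^bsub>X\<^esub>)"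
  proof
    show "(\<lambda>x\<in>prod_carrier E. (- 1) \<odot>\<^bsub>X\<^esub> T x) \<in> multilinear_ops K E X"
      using T by (intro smult_multilinear_ops) auto
    have "(- 1) \<odot>\<^bsub>X\<^esub> T x \<oplus>\<^bsub>X\<^esub> T x = \<zero>\<^bsub>X\<^esub>" if "x \<in> prod_carrier E" for x
      using multilinear_ops_closed[OF T that] by (simp add: X.M.M.l_neg flip: X.uminus_smult)
    then show "(\<lambda>x\<in>prod_carrier E. (\<lambda>x\<in>prod_carrier E. (- 1) \<odot>\<^bsub>X\<^esub> T x) x \<oplus>\<^bsub>X\<^esub> T x)
        = (\<lambda>x\<in>prod_carrier E. \<zero>\<^bsub>X\<^esub>)"
      by (auto simp: restrict_def)
  qed
next
  fix T assume T: "T \<in> multilinear_ops K E X"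
  note c = multilinear_ops_closed[OF T]
  show "(\<lambda>x\<in>prod_carrier E. 1 \<odot>\<^bsub>X\<^esub> T x) = T"
    using T c by (intro multilinear_ops_eqI smult_multilinear_ops) (auto simp: X.smult_simps)
  show "(\<lambda>x\<in>prod_carrier E. (\<lambda>x\<in>prod_carrier E. \<zero>\<^bsub>X\<^esub>) x \<oplus>\<^bsub>X\<^esub> T x) = T"
    using T c by (intro multilinear_ops_eqI add_multilinear_ops zero_multilinear) auto
qed (auto intro!: zero_multilinear add_multilinear_ops smult_multilinear_ops restrict_ext
      simp: multilinear_ops_closed X.M.M.a_ac X.smult_simps)

end

locale multi_lattices = scalar_field K for K +
  fixes E :: "'m::finite \<Rightarrow> ('a, 'y) lspace_scheme" and X :: "('b, 'z) nspace_scheme"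
  assumes lattice_factors: "\<And>j. banach_lattice K (E j)" and banach_target: "banach_space K X"
begin

sublocale multi_spaces K E X
  using lattice_factors banach_target
  by unfold_locales (auto simp: banach_lattice_def banach_space_def)

sublocale B: banach_lat K "E j" for j
  using lattice_factors by unfold_locales

text \<open>
  Induction on the set of coordinates that are not required to be positive: with all other coordinates
  fixed, \<open>a \<mapsto> \<parallel>T (\<dots>, a, \<dots>)\<parallel>\<close> is a seminorm, and freeing one coordinate costs a factor \<open>6\<close>.
\<close>

lemma multilinear_bound_of_pos_cone:
  assumes T: "multilinear_map K E X T" and C: "0 \<le> C"
    and pos: "\<And>x. (\<And>j. x j \<in> pos_cone (E j)) \<Longrightarrow> vnorm X (T x) \<le> C * (\<Prod>j\<in>UNIV. vnorm (E j) (x j))"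
    and x: "x \<in> prod_carrier E"
  shows "vnorm X (T x) \<le> 6 ^ CARD('m) * C * (\<Prod>j\<in>UNIV. vnorm (E j) (x j))"
proof -
  have "vnorm X (T x) \<le> 6 ^ card A * C * (\<Prod>j\<in>UNIV. vnorm (E j) (x j))"
    if "x \<in> prod_carrier E" "\<And>j. j \<notin> A \<Longrightarrow> x j \<in> pos_cone (E j)" for A x
    using finite[of A] that
  proof (induction A arbitrary: x rule: finite_induct)
    case empty
    then show ?case using pos by simp
  next
    case (insert k A)
    define P where "P = (\<Prod>j\<in>UNIV - {k}. vnorm (E j) (x j))"
    have P: "0 \<le> P"
      using insert.prems unfolding P_def by (intro prod_nonneg) (auto simp: E.vnorm_props prod_carrierD)
    have split: "(\<Prod>j\<in>UNIV. vnorm (E j) ((x(k := a)) j)) = P * vnorm (E k) a" for a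
      unfolding P_def by (subst prod.remove[of _ k]) (auto intro!: prod.cong)
    have "vnorm X (T (x(k := x k))) \<le> 6 * (6 ^ card A * C * P) * vnorm (E k) (x k)"
    proof (rule B.seminorm_le_of_pos_cone[where \<phi> = "\<lambda>a. vnorm X (T (x(k := a)))"])
      show "0 \<le> 6 ^ card A * C * P" using C P by simp
      show "vnorm X (T (x(k := a))) \<le> 6 ^ card A * C * P * vnorm (E k) a" if "a \<in> pos_cone (E k)" for a
      proof -
        have "vnorm X (T (x(k := a))) \<le> 6 ^ card A * C * (\<Prod>j\<in>UNIV. vnorm (E j) ((x(k := a)) j))"
          using prod_carrier_update[OF insert.prems(1) B.pos_cone_carrier[OF that]]
            insert.prems(2) that by (intro insert.IH[of "x(k := a)"]) (auto simp del: fun_upd_apply, auto)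
        then show ?thesis unfolding split by (simp add: mult.assoc)
      qed
    next
      fix a b assume "a \<in> carrier (E k)" "b \<in> carrier (E k)"
      then show "vnorm X (T (x(k := a \<oplus>\<^bsub>E k\<^esub> b))) \<le> vnorm X (T (x(k := a))) + vnorm X (T (x(k := b)))"
        using insert.prems by (simp add: multilinear_mapD(1,3,4)[OF T] X.vnorm_props prod_carrier_update)
    next
      fix c a assume "c \<in> K" "a \<in> carrier (E k)"
      then show "vnorm X (T (x(k := c \<odot>\<^bsub>E k\<^esub> a))) = cmod c * vnorm X (T (x(k := a)))"
        using insert.prems by (simp add: multilinear_mapD(1,3,4)[OF T] X.vnorm_props prod_carrier_update)
    qed (use insert.prems in \<open>auto simp: prod_carrierD\<close>)
    then show ?case using insert.hyps split[of "x k"] by (simp add: mult.assoc)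
  qed
  from this[of x UNIV] x show ?thesis by simp
qed

end

section \<open>The Banach space of positive dominated operators\<close>

locale conjugate_exponents =
  fixes p :: ennreal and ps :: "'m::finite \<Rightarrow> ennreal"
  assumes p_ge: "1 \<le> p" and ps_ge: "\<And>j. 1 \<le> ps j"
    and conj: "1 / p = (\<Sum>j\<in>UNIV. 1 / ps j)"

locale dominated_component = multi_lattices K E X + conjugate_exponents p ps
  for K :: "complex set" and E :: "'m::finite \<Rightarrow> 'a lspace" and X :: "'b nspace"
    and p :: ennreal and ps :: "'m \<Rightarrow> ennreal"
begin

abbreviation "weak_prod n x \<equiv> (\<Prod>j\<in>UNIV. weak_norm K (E j) (ps j) n (\<lambda>i. x i j))"

abbreviation "dbound \<equiv> dominated_bound K p ps E X"

abbreviation "\<pi> \<equiv> pos_dominated_norm K p ps E X"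

abbreviation "\<D> \<equiv> pos_dominated K p ps E X"

lemma dboundD:
  assumes "dbound T C" "0 < n" "\<And>i j. i < n \<Longrightarrow> x i j \<in> pos_cone (E j)"
  shows "lp_norm p n (\<lambda>i. vnorm X (T (x i))) \<le> C * weak_prod n x"
  using assms by (simp add: dominated_bound_def)

lemma dboundI:
  assumes "\<And>n x. 0 < n \<Longrightarrow> (\<And>i j. i < n \<Longrightarrow> x i j \<in> pos_cone (E j)) \<Longrightarrow>
    lp_norm p n (\<lambda>i. vnorm X (T (x i))) \<le> C * weak_prod n x"
  shows "dbound T C"
  using assms by (simp add: dominated_bound_def)

lemma weak_prod_nonneg:
  assumes "0 < n" "\<And>i j. i < n \<Longrightarrow> x i j \<in> pos_cone (E j)"
  shows "0 \<le> weak_prod n x"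
  using assms B.pos_cone_carrier by (intro prod_nonneg ballI E.weak_norm_nonneg ps_ge) auto

lemma pos_cone_prod_carrier: "(\<And>j. x j \<in> pos_cone (E j)) \<Longrightarrow> x \<in> prod_carrier E"
  by (simp add: prod_carrier_def B.pos_cone_carrier)

lemma dbound_mono:
  assumes "dbound T C" "C \<le> D"
  shows "dbound T D"
proof (rule dboundI)
  fix n :: nat and x :: "nat \<Rightarrow> 'm \<Rightarrow> 'a"
  assume nx: "0 < n" "\<And>i j. i < n \<Longrightarrow> x i j \<in> pos_cone (E j)"
  have "C * weak_prod n x \<le> D * weak_prod n x"
    using assms(2) weak_prod_nonneg[of n x, OF nx] by (rule mult_right_mono)
  then show "lp_norm p n (\<lambda>i. vnorm X (T (x i))) \<le> D * weak_prod n x"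
    using dboundD[where x = x, OF assms(1) nx] by linarith
qed

lemma dbound_add:
  assumes S: "multilinear_map K E X S" "dbound S C" and T: "multilinear_map K E X T" "dbound T D"
  shows "dbound (\<lambda>x\<in>prod_carrier E. S x \<oplus>\<^bsub>X\<^esub> T x) (C + D)"
proof (rule dboundI)
  fix n :: nat and x :: "nat \<Rightarrow> 'm \<Rightarrow> 'a"
  assume nx: "0 < n" "\<And>i j. i < n \<Longrightarrow> x i j \<in> pos_cone (E j)"
  have x: "x i \<in> prod_carrier E" if "i < n" for i using nx that pos_cone_prod_carrier by blast
  note c = multilinear_mapD(1)[OF S(1)] multilinear_mapD(1)[OF T(1)]
  have "lp_norm p n (\<lambda>i. vnorm X ((\<lambda>x\<in>prod_carrier E. S x \<oplus>\<^bsub>X\<^esub> T x) (x i)))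
      \<le> lp_norm p n (\<lambda>i. vnorm X (S (x i)) + vnorm X (T (x i)))"
    using x c by (intro lp_norm_mono[OF nx(1) p_ge]) (auto simp: X.vnorm_props)
  also have "\<dots> \<le> lp_norm p n (\<lambda>i. vnorm X (S (x i))) + lp_norm p n (\<lambda>i. vnorm X (T (x i)))"
    using x c by (intro lp_norm_triangle[OF nx(1) p_ge]) (auto simp: X.vnorm_props)
  also have "\<dots> \<le> C * weak_prod n x + D * weak_prod n x"
    using dboundD[where x = x, OF S(2) nx] dboundD[where x = x, OF T(2) nx] by (rule add_mono)
  finally show "lp_norm p n (\<lambda>i. vnorm X ((\<lambda>x\<in>prod_carrier E. S x \<oplus>\<^bsub>X\<^esub> T x) (x i)))
      \<le> (C + D) * weak_prod n x" by (simp add: distrib_right)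
qed

lemma dbound_smult:
  assumes T: "multilinear_map K E X T" "dbound T C" and c: "c \<in> K"
  shows "dbound (\<lambda>x\<in>prod_carrier E. c \<odot>\<^bsub>X\<^esub> T x) (cmod c * C)"
proof (rule dboundI)
  fix n :: nat and x :: "nat \<Rightarrow> 'm \<Rightarrow> 'a"
  assume nx: "0 < n" "\<And>i j. i < n \<Longrightarrow> x i j \<in> pos_cone (E j)"
  have x: "x i \<in> prod_carrier E" if "i < n" for i using nx that pos_cone_prod_carrier by blast
  have "lp_norm p n (\<lambda>i. vnorm X ((\<lambda>x\<in>prod_carrier E. c \<odot>\<^bsub>X\<^esub> T x) (x i)))
      = lp_norm p n (\<lambda>i. cmod c * vnorm X (T (x i)))"
    using x c by (intro lp_norm_cong) (simp add: X.vnorm_props multilinear_mapD(1)[OF T(1)])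
  also have "\<dots> = cmod c * lp_norm p n (\<lambda>i. vnorm X (T (x i)))"
    using x by (intro lp_norm_scale[OF nx(1) p_ge]) (auto simp: X.vnorm_props multilinear_mapD(1)[OF T(1)])
  also have "\<dots> \<le> cmod c * (C * weak_prod n x)"
    using dboundD[where x = x, OF T(2) nx] by (intro mult_left_mono) auto
  finally show "lp_norm p n (\<lambda>i. vnorm X ((\<lambda>x\<in>prod_carrier E. c \<odot>\<^bsub>X\<^esub> T x) (x i)))
      \<le> cmod c * C * weak_prod n x" by (simp add: mult.assoc)
qed

text \<open>
  For a fixed finite family the inequality compares a continuous function of finitely many values of
  the operator with a constant, so it survives pointwise limits.
\<close>

lemma dbound_limit:
  assumes S: "\<And>k. multilinear_map K E X (S k)" and db: "\<And>k. N \<le> k \<Longrightarrow> dbound (S k) C"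
    and lim: "\<And>x. x \<in> prod_carrier E \<Longrightarrow> X.vlim (\<lambda>k. S k x) (T x)"
  shows "dbound T C"
proof (rule dboundI)
  fix n :: nat and x :: "nat \<Rightarrow> 'm \<Rightarrow> 'a"
  assume nx: "0 < n" "\<And>i j. i < n \<Longrightarrow> x i j \<in> pos_cone (E j)"
  have x: "x i \<in> prod_carrier E" if "i < n" for i using nx that pos_cone_prod_carrier by blast
  have "(\<lambda>k. lp_norm p n (\<lambda>i. vnorm X (S k (x i)))) \<longlonglongrightarrow> lp_norm p n (\<lambda>i. vnorm X (T (x i)))"
    using x lim by (intro tendsto_lp_norm[OF nx(1) p_ge] X.vlim_vnorm)
      (auto simp: X.vnorm_props multilinear_mapD(1)[OF S])
  moreover have "\<forall>k\<ge>N. lp_norm p n (\<lambda>i. vnorm X (S k (x i))) \<le> C * weak_prod n x"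
    using dboundD[where x = x, OF db nx] by blast
  ultimately show "lp_norm p n (\<lambda>i. vnorm X (T (x i))) \<le> C * weak_prod n x"
    by (rule LIMSEQ_le_const2[OF _ exI])
qed

text \<open>
  The instance \<open>n = 1\<close> of domination, extended from the positive cones.
\<close>

lemma dbound_imp_bounded:
  assumes T: "multilinear_map K E X T" "dbound T C" and C: "0 \<le> C" and x: "x \<in> prod_carrier E"
  shows "vnorm X (T x) \<le> 6 ^ CARD('m) * C * (\<Prod>j\<in>UNIV. vnorm (E j) (x j))"
proof (rule multilinear_bound_of_pos_cone[OF T(1) C _ x])
  fix y assume y: "\<And>j. y j \<in> pos_cone (E j)"
  note yc = B.pos_cone_carrier[OF y]
  have "vnorm X (T y) = lp_norm p 1 (\<lambda>i. vnorm X (T y))"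
    using lp_norm_single[OF p_ge, of "\<lambda>i. vnorm X (T y)"]
    by (simp add: X.vnorm_props multilinear_mapD(1)[OF T(1)] pos_cone_prod_carrier y)
  also have "\<dots> \<le> C * weak_prod 1 (\<lambda>i. y)"
    using dboundD[OF T(2), of 1 "\<lambda>i. y"] y by simp
  also have "\<dots> \<le> C * (\<Prod>j\<in>UNIV. vnorm (E j) (y j))"
    using C yc by (intro mult_left_mono prod_mono conjI E.weak_norm_single_le E.weak_norm_nonneg ps_ge) auto
  finally show "vnorm X (T y) \<le> C * (\<Prod>j\<in>UNIV. vnorm (E j) (y j))" .
qed

lemma pos_dominatedI:
  assumes T: "multilinear_map K E X T" "dbound T C" and C: "0 \<le> C"
  shows "T \<in> \<D>"
proof -
  have "dbound T (C + 1)" using dbound_mono[OF T(2)] by simp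
  moreover have "T \<in> multilinear_ops K E X"
    unfolding multilinear_ops_iff using T dbound_imp_bounded[OF T C] by blast
  ultimately show ?thesis using C unfolding pos_dominated_def by (auto intro!: exI[of _ "C + 1"])
qed

lemma pos_dominatedD:
  assumes "T \<in> \<D>"
  shows "T \<in> multilinear_ops K E X" "multilinear_map K E X T"
  using assms by (auto simp: pos_dominated_def multilinear_ops_iff)

lemma pos_dominated_norm_le:
  assumes "dbound T C" "0 \<le> C"
  shows "\<pi> T \<le> C"
proof (rule field_le_epsilon)
  fix e :: real assume "0 < e"
  then have "C + e \<in> {C. 0 < C \<and> dbound T C}" using assms dbound_mono[OF assms(1)] by auto
  then show "\<pi> T \<le> C + e"
    unfolding pos_dominated_norm_def by (intro cInf_lower bdd_belowI[of _ 0]) auto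
qed

text \<open>
  The infimum defining \<open>\<pi>\<^sup>+\<close> is itself a domination constant: each single inequality is closed
  in the constant.
\<close>

lemma
  assumes T: "T \<in> \<D>"
  shows pos_dominated_norm_nonneg: "0 \<le> \<pi> T"
    and dbound_pos_dominated_norm: "dbound T (\<pi> T)"
proof -
  let ?S = "{C. 0 < C \<and> dbound T C}"
  have S: "?S \<noteq> {}" using T by (auto simp: pos_dominated_def)
  then show "0 \<le> \<pi> T" unfolding pos_dominated_norm_def by (intro cInf_greatest) auto
  show "dbound T (\<pi> T)"
  proof (rule dboundI)
    fix n :: nat and x :: "nat \<Rightarrow> 'm \<Rightarrow> 'a"
    assume nx: "0 < n" "\<And>i j. i < n \<Longrightarrow> x i j \<in> pos_cone (E j)"
    let ?l = "lp_norm p n (\<lambda>i. vnorm X (T (x i)))"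
    have le: "?l \<le> C * weak_prod n x" if "C \<in> ?S" for C
      using that dboundD[of T C n x] nx by auto
    show "?l \<le> \<pi> T * weak_prod n x"
    proof (cases "weak_prod n x = 0")
      case True
      obtain C where "C \<in> ?S" using S by blast
      from le[OF this] show ?thesis unfolding True by simp
    next
      case False
      then have w: "0 < weak_prod n x" using weak_prod_nonneg[of n x, OF nx] by linarith
      have "?l / weak_prod n x \<le> \<pi> T"
        unfolding pos_dominated_norm_def using S le w by (intro cInf_greatest) (auto simp: divide_le_eq)
      then show ?thesis using w by (simp add: divide_le_eq)
    qed
  qed
qed

lemma pos_dominated_bounded:
  assumes "T \<in> \<D>" "x \<in> prod_carrier E"
  shows "vnorm X (T x) \<le> 6 ^ CARD('m) * \<pi> T * (\<Prod>j\<in>UNIV. vnorm (E j) (x j))"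
  using assms
  by (intro dbound_imp_bounded pos_dominatedD dbound_pos_dominated_norm pos_dominated_norm_nonneg)

lemma add_pos_dominated:
  assumes S: "S \<in> \<D>" and T: "T \<in> \<D>"
  shows "(\<lambda>x\<in>prod_carrier E. S x \<oplus>\<^bsub>X\<^esub> T x) \<in> \<D>"
    and "\<pi> (\<lambda>x\<in>prod_carrier E. S x \<oplus>\<^bsub>X\<^esub> T x) \<le> \<pi> S + \<pi> T"
proof -
  note m = pos_dominatedD(2)[OF S] pos_dominatedD(2)[OF T]
  note n = add_nonneg_nonneg[OF pos_dominated_norm_nonneg[OF S] pos_dominated_norm_nonneg[OF T]]
  note d = dbound_add[OF m(1) dbound_pos_dominated_norm[OF S] m(2) dbound_pos_dominated_norm[OF T]]
  show "(\<lambda>x\<in>prod_carrier E. S x \<oplus>\<^bsub>X\<^esub> T x) \<in> \<D>"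
    by (rule pos_dominatedI[OF add_multilinear[OF m] d n])
  show "\<pi> (\<lambda>x\<in>prod_carrier E. S x \<oplus>\<^bsub>X\<^esub> T x) \<le> \<pi> S + \<pi> T"
    by (rule pos_dominated_norm_le[OF d n])
qed

lemma smult_pos_dominated:
  assumes T: "T \<in> \<D>" and c: "c \<in> K"
  shows "(\<lambda>x\<in>prod_carrier E. c \<odot>\<^bsub>X\<^esub> T x) \<in> \<D>"
    and "\<pi> (\<lambda>x\<in>prod_carrier E. c \<odot>\<^bsub>X\<^esub> T x) \<le> cmod c * \<pi> T"
proof -
  note m = pos_dominatedD(2)[OF T]
  have n: "0 \<le> cmod c * \<pi> T" using pos_dominated_norm_nonneg[OF T] by simp
  note d = dbound_smult[OF m dbound_pos_dominated_norm[OF T] c]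
  show "(\<lambda>x\<in>prod_carrier E. c \<odot>\<^bsub>X\<^esub> T x) \<in> \<D>"
    by (rule pos_dominatedI[OF smult_multilinear[OF m c] d n])
  show "\<pi> (\<lambda>x\<in>prod_carrier E. c \<odot>\<^bsub>X\<^esub> T x) \<le> cmod c * \<pi> T"
    by (rule pos_dominated_norm_le[OF d n])
qed

lemma zero_pos_dominated:
  shows "(\<lambda>x\<in>prod_carrier E. \<zero>\<^bsub>X\<^esub>) \<in> \<D>" and "\<pi> (\<lambda>x\<in>prod_carrier E. \<zero>\<^bsub>X\<^esub>) = 0"
proof -
  have d: "dbound (\<lambda>x\<in>prod_carrier E. \<zero>\<^bsub>X\<^esub>) 0"
  proof (rule dboundI)
    fix n :: nat and x :: "nat \<Rightarrow> 'm \<Rightarrow> 'a"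
    assume nx: "0 < n" "\<And>i j. i < n \<Longrightarrow> x i j \<in> pos_cone (E j)"
    have "lp_norm p n (\<lambda>i. vnorm X ((\<lambda>x\<in>prod_carrier E. \<zero>\<^bsub>X\<^esub>) (x i))) = lp_norm p n (\<lambda>i. 0 * 1)"
      using nx by (intro lp_norm_cong) (simp add: pos_cone_prod_carrier)
    also have "\<dots> = 0" using lp_norm_scale[OF nx(1) p_ge, of 0 "\<lambda>_. 1"] by simp
    finally show "lp_norm p n (\<lambda>i. vnorm X ((\<lambda>x\<in>prod_carrier E. \<zero>\<^bsub>X\<^esub>) (x i))) \<le> 0 * weak_prod n x"
      by simp
  qed
  show z: "(\<lambda>x\<in>prod_carrier E. \<zero>\<^bsub>X\<^esub>) \<in> \<D>"
    using zero_multilinear d by (intro pos_dominatedI[OF _ d]) (auto simp: multilinear_ops_iff)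
  show "\<pi> (\<lambda>x\<in>prod_carrier E. \<zero>\<^bsub>X\<^esub>) = 0"
    using pos_dominated_norm_le[OF d] pos_dominated_norm_nonneg[OF z] by simp
qed

lemma submodule_pos_dominated: "submodule \<D> (scalar_ring K) (multilinear_space K E X)"
proof -
  interpret S: module "scalar_ring K" "multilinear_space K E X" by (rule module_multilinear_space)
  show ?thesis
  proof (rule S.submoduleI)
    show "\<D> \<subseteq> carrier (multilinear_space K E X)"
      using pos_dominatedD(1) by (auto simp: multilinear_space_simps)
    show "\<zero>\<^bsub>multilinear_space K E X\<^esub> \<in> \<D>" by (simp add: multilinear_space_simps zero_pos_dominated)
    show "S \<oplus>\<^bsub>multilinear_space K E X\<^esub> T \<in> \<D>" if "S \<in> \<D>" "T \<in> \<D>" for S T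
      using add_pos_dominated(1)[OF that] by (simp add: multilinear_space_simps)
    show sm: "c \<odot>\<^bsub>multilinear_space K E X\<^esub> T \<in> \<D>" if "c \<in> carrier (scalar_ring K)" "T \<in> \<D>" for c T
      using smult_pos_dominated(1)[OF that(2), of c] that(1) by (simp add: multilinear_space_simps)
    show "\<ominus>\<^bsub>multilinear_space K E X\<^esub> T \<in> \<D>" if T: "T \<in> \<D>" for T
    proof -
      have "T \<in> carrier (multilinear_space K E X)"
        using pos_dominatedD(1)[OF T] by (simp add: multilinear_space_simps)
      then have "(- 1) \<odot>\<^bsub>multilinear_space K E X\<^esub> T = \<ominus>\<^bsub>multilinear_space K E X\<^esub> T"
        using S.smult_l_minus[of 1 T] S.smult_one[of T] by (simp add: minus_one_scalar_ring)
      then show ?thesis using sm[of "- 1" T] T by simp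
    qed
  qed
qed

definition "dominated_space = multilinear_space K E X \<lparr>carrier := \<D>, vnorm := \<pi>\<rparr>"

lemma dominated_space_simps:
  "carrier dominated_space = \<D>" "vnorm dominated_space = \<pi>"
  "\<zero>\<^bsub>dominated_space\<^esub> = (\<lambda>x\<in>prod_carrier E. \<zero>\<^bsub>X\<^esub>)"
  "S \<oplus>\<^bsub>dominated_space\<^esub> T = (\<lambda>x\<in>prod_carrier E. S x \<oplus>\<^bsub>X\<^esub> T x)"
  "c \<odot>\<^bsub>dominated_space\<^esub> T = (\<lambda>x\<in>prod_carrier E. c \<odot>\<^bsub>X\<^esub> T x)"
  by (simp_all add: dominated_space_def multilinear_space_simps)

lemma normed_dominated_space: "normed_space K dominated_space"
  unfolding normed_space_def dominated_space_simps
proof (intro conjI ballI)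
  have "module (scalar_ring K) (multilinear_space K E X \<lparr>carrier := \<D>\<rparr>)"
    by (rule submodule.submodule_is_module[OF submodule_pos_dominated module_multilinear_space])
  then show "module (scalar_ring K) dominated_space"
    by (simp add: dominated_space_def module_def module_axioms_def abelian_group_def
        abelian_group_axioms_def abelian_monoid_def)
  fix T assume T: "T \<in> \<D>"
  show "0 \<le> \<pi> T" using pos_dominated_norm_nonneg[OF T] .
  show "\<pi> T = 0 \<longleftrightarrow> T = (\<lambda>x\<in>prod_carrier E. \<zero>\<^bsub>X\<^esub>)"
  proof
    assume z: "\<pi> T = 0"
    show "T = (\<lambda>x\<in>prod_carrier E. \<zero>\<^bsub>X\<^esub>)"
    proof (rule multilinear_ops_eqI[OF pos_dominatedD(1)[OF T] zero_multilinear])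
      fix x assume x: "x \<in> prod_carrier E"
      note c = multilinear_mapD(1)[OF pos_dominatedD(2)[OF T] x]
      have "vnorm X (T x) = 0" using pos_dominated_bounded[OF T x] X.vnorm_props(1)[OF c] z by simp
      then show "T x = (\<lambda>x\<in>prod_carrier E. \<zero>\<^bsub>X\<^esub>) x" using x c by (simp add: X.vnorm_props)
    qed
  qed (simp add: zero_pos_dominated)
  show "\<pi> (\<lambda>x\<in>prod_carrier E. c \<odot>\<^bsub>X\<^esub> T x) = cmod c * \<pi> T" if c: "c \<in> K" for c
  proof (cases "c = 0")
    case True
    have "(\<lambda>x\<in>prod_carrier E. c \<odot>\<^bsub>X\<^esub> T x) = (\<lambda>x\<in>prod_carrier E. \<zero>\<^bsub>X\<^esub>)"
      using multilinear_mapD(1)[OF pos_dominatedD(2)[OF T]] True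
      by (intro restrict_ext) (simp add: X.smult_simps)
    then show ?thesis using True by (simp add: zero_pos_dominated)
  next
    case False
    let ?S = "\<lambda>x\<in>prod_carrier E. c \<odot>\<^bsub>X\<^esub> T x"
    have S: "?S \<in> \<D>" by (rule smult_pos_dominated(1)[OF T c])
    have ic: "inverse c \<in> K" using c by simp
    have "(\<lambda>x\<in>prod_carrier E. inverse c \<odot>\<^bsub>X\<^esub> ?S x) = T"
    proof (rule multilinear_ops_eqI)
      show "(\<lambda>x\<in>prod_carrier E. inverse c \<odot>\<^bsub>X\<^esub> ?S x) \<in> multilinear_ops K E X"
        by (rule pos_dominatedD(1)[OF smult_pos_dominated(1)[OF S ic]])
      fix x assume x: "x \<in> prod_carrier E"
      show "(\<lambda>x\<in>prod_carrier E. inverse c \<odot>\<^bsub>X\<^esub> ?S x) x = T x"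
        using multilinear_mapD(1)[OF pos_dominatedD(2)[OF T] x] x c False
        by (simp add: X.smult_simps flip: X.smult_simps(3))
    qed (rule pos_dominatedD(1)[OF T])
    then have "\<pi> T \<le> cmod (inverse c) * \<pi> ?S" using smult_pos_dominated(2)[OF S ic] by simp
    then have "cmod c * \<pi> T \<le> cmod c * (cmod (inverse c) * \<pi> ?S)" by (rule mult_left_mono) simp
    also have "\<dots> = \<pi> ?S" using False by (simp add: norm_inverse)
    finally show ?thesis using smult_pos_dominated(2)[OF T c] by simp
  qed
qed (use add_pos_dominated(2) in blast)

sublocale D: normed_module K dominated_space
  by unfold_locales (rule normed_dominated_space)

lemma dominated_space_minus:
  assumes "T \<in> \<D>" "x \<in> prod_carrier E"
  shows "(S \<ominus>\<^bsub>dominated_space\<^esub> T) x = S x \<ominus>\<^bsub>X\<^esub> T x"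
  using assms D.minus_smult[of T S] multilinear_mapD(1)[OF pos_dominatedD(2)[OF assms(1)] assms(2)]
  by (simp add: dominated_space_simps X.minus_smult)

lemma multilinear_map_limit:
  assumes S: "\<And>n. multilinear_map K E X (S n)"
    and lim: "\<And>x. x \<in> prod_carrier E \<Longrightarrow> X.vlim (\<lambda>n. S n x) (T x)"
  shows "multilinear_map K E X (restrict T (prod_carrier E))"
proof (intro multilinear_map_restrictI scalar_field_axioms normed_factors)
  show "T x \<in> carrier X" if "x \<in> prod_carrier E" for x using lim[OF that] by (simp add: X.vlim_def)
  fix x j a assume x: "x \<in> prod_carrier E" and a: "a \<in> carrier (E j)"
  show "T (x(j := a \<oplus>\<^bsub>E j\<^esub> b)) = T (x(j := a)) \<oplus>\<^bsub>X\<^esub> T (x(j := b))" if b: "b \<in> carrier (E j)" for b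
  proof (rule X.vlim_unique)
    show "X.vlim (\<lambda>n. S n (x(j := a \<oplus>\<^bsub>E j\<^esub> b))) (T (x(j := a \<oplus>\<^bsub>E j\<^esub> b)))"
      using x a b by (intro lim prod_carrier_update) auto
    show "X.vlim (\<lambda>n. S n (x(j := a \<oplus>\<^bsub>E j\<^esub> b))) (T (x(j := a)) \<oplus>\<^bsub>X\<^esub> T (x(j := b)))"
      unfolding multilinear_mapD(3)[OF S x a b]
      using x a b by (intro X.vlim_add lim prod_carrier_update)
  qed
  show "T (x(j := c \<odot>\<^bsub>E j\<^esub> a)) = c \<odot>\<^bsub>X\<^esub> T (x(j := a))" if c: "c \<in> K" for c
  proof (rule X.vlim_unique)
    show "X.vlim (\<lambda>n. S n (x(j := c \<odot>\<^bsub>E j\<^esub> a))) (T (x(j := c \<odot>\<^bsub>E j\<^esub> a)))"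
      using x a c by (intro lim prod_carrier_update) auto
    show "X.vlim (\<lambda>n. S n (x(j := c \<odot>\<^bsub>E j\<^esub> a))) (c \<odot>\<^bsub>X\<^esub> T (x(j := a)))"
      unfolding multilinear_mapD(4)[OF S x c a]
      using x a c by (intro X.vlim_smult lim prod_carrier_update)
  qed
qed

text \<open>
  The tail differences \<open>s\<^sub>n - s\<^sub>m\<close> are dominated with constant \<open>e\<close>; letting \<open>m\<close> tend to infinity
  with \<open>n\<close> fixed transfers this to \<open>s\<^sub>n - T\<close> for the pointwise limit \<open>T\<close>.
\<close>

lemma banach_dominated_space: "banach_space K dominated_space"
  unfolding D.banach_space_iff
proof (intro allI impI)
  fix s assume s: "D.vCauchy s"
  have sP: "s n \<in> \<D>" for n using s by (simp add: D.vCauchy_def dominated_space_simps)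
  have cauchy: "\<exists>N. \<forall>m\<ge>N. \<forall>n\<ge>N. \<pi> (s m \<ominus>\<^bsub>dominated_space\<^esub> s n) < e" if "0 < e" for e
    using s that by (simp add: D.vCauchy_def dominated_space_simps)
  have diffP: "s m \<ominus>\<^bsub>dominated_space\<^esub> s n \<in> \<D>" for m n
    using D.closed(3)[of "s m" "s n"] sP by (simp add: dominated_space_simps)
  have sc: "s n x \<in> carrier X" if "x \<in> prod_carrier E" for n x
    using multilinear_mapD(1)[OF pos_dominatedD(2)[OF sP] that] .
  have "\<exists>l. X.vlim (\<lambda>n. s n x) l" if x: "x \<in> prod_carrier E" for x
  proof -
    \<comment> \<open>The summand 1 makes R positive even if some coordinate of x vanishes.\<close>
    define R where "R = 6 ^ CARD('m) * (\<Prod>j\<in>UNIV. vnorm (E j) (x j)) + 1"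
    have R: "0 < R" using prod_vnorm_nonneg[OF x] by (simp add: R_def add_nonneg_pos)
    have le: "vnorm X (s m x \<ominus>\<^bsub>X\<^esub> s n x) \<le> R * \<pi> (s m \<ominus>\<^bsub>dominated_space\<^esub> s n)" for m n
      using pos_dominated_bounded[OF diffP x, of m n] pos_dominated_norm_nonneg[OF diffP, of m n]
      by (simp add: dominated_space_minus[OF sP x] R_def algebra_simps)
    have "X.vCauchy (\<lambda>n. s n x)"
      unfolding X.vCauchy_def
    proof (intro conjI allI impI)
      fix e :: real assume "0 < e"
      then obtain N where N: "\<And>m n. N \<le> m \<Longrightarrow> N \<le> n \<Longrightarrow> \<pi> (s m \<ominus>\<^bsub>dominated_space\<^esub> s n) < e / R"
        using cauchy[of "e / R"] R by auto
      have "vnorm X (s m x \<ominus>\<^bsub>X\<^esub> s n x) < e" if "N \<le> m" "N \<le> n" for m n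
        using le[of m n] mult_strict_left_mono[OF N[OF that] R] R by simp
      then show "\<exists>N. \<forall>m\<ge>N. \<forall>n\<ge>N. vnorm X (s m x \<ominus>\<^bsub>X\<^esub> s n x) < e" by blast
    qed (rule sc[OF x])
    then show ?thesis using banach_target by (simp add: X.banach_space_iff)
  qed
  then obtain L where L: "\<And>x. x \<in> prod_carrier E \<Longrightarrow> X.vlim (\<lambda>n. s n x) (L x)" by metis
  define T where "T = restrict L (prod_carrier E)"
  have Tm: "multilinear_map K E X T"
    unfolding T_def using pos_dominatedD(2)[OF sP] L by (rule multilinear_map_limit)
  have Tc: "T x \<in> carrier X" if "x \<in> prod_carrier E" for x using multilinear_mapD(1)[OF Tm that] .
  define U where "U n = (\<lambda>x\<in>prod_carrier E. s n x \<oplus>\<^bsub>X\<^esub> (\<lambda>x\<in>prod_carrier E. (- 1) \<odot>\<^bsub>X\<^esub> T x) x)" for n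
  have Um: "multilinear_map K E X (U n)" for n
    unfolding U_def by (intro add_multilinear smult_multilinear Tm pos_dominatedD(2)[OF sP]) auto
  have Ux: "U n x = s n x \<ominus>\<^bsub>X\<^esub> T x" if "x \<in> prod_carrier E" for n x
    using that Tc by (simp add: U_def X.minus_smult)
  have small: "\<exists>N. \<forall>n\<ge>N. dbound (U n) e" if "0 < e" for e
  proof -
    obtain N where N: "\<And>m n. N \<le> m \<Longrightarrow> N \<le> n \<Longrightarrow> \<pi> (s m \<ominus>\<^bsub>dominated_space\<^esub> s n) < e"
      using cauchy[OF \<open>0 < e\<close>] by blast
    have "dbound (U n) e" if n: "N \<le> n" for n
    proof (rule dbound_limit[where N = N and S = "\<lambda>m. s n \<ominus>\<^bsub>dominated_space\<^esub> s m"])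
      show "multilinear_map K E X (s n \<ominus>\<^bsub>dominated_space\<^esub> s m)" for m
        by (rule pos_dominatedD(2)[OF diffP])
      show "dbound (s n \<ominus>\<^bsub>dominated_space\<^esub> s m) e" if "N \<le> m" for m
        using dbound_mono[OF dbound_pos_dominated_norm[OF diffP]] N[OF n that] by (simp add: less_imp_le)
      fix x assume x: "x \<in> prod_carrier E"
      have "X.vlim (\<lambda>m. s n x \<oplus>\<^bsub>X\<^esub> (- 1) \<odot>\<^bsub>X\<^esub> s m x) (s n x \<oplus>\<^bsub>X\<^esub> (- 1) \<odot>\<^bsub>X\<^esub> T x)"
        using L[OF x] sc[OF x] x by (intro X.vlim_add X.vlim_smult X.vlim_const) (auto simp: T_def)
      then show "X.vlim (\<lambda>m. (s n \<ominus>\<^bsub>dominated_space\<^esub> s m) x) (U n x)"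
        by (simp add: dominated_space_minus[OF sP x] Ux[OF x] X.minus_smult sc[OF x] Tc[OF x])
    qed
    then show ?thesis by blast
  qed
  obtain k where k: "dbound (U k) 1" using small[of 1] by auto
  have UP: "U k \<in> \<D>" by (rule pos_dominatedI[OF Um k]) simp
  have "T = s k \<ominus>\<^bsub>dominated_space\<^esub> U k"
  proof
    fix x show "T x = (s k \<ominus>\<^bsub>dominated_space\<^esub> U k) x"
    proof (cases "x \<in> prod_carrier E")
      case True
      then show ?thesis
        using dominated_space_minus[OF UP True] sc Tc by (simp add: Ux X.minus_minus_cancel)
    next
      case False
      have P: "s k \<ominus>\<^bsub>dominated_space\<^esub> U k \<in> \<D>"
        using D.closed(3)[of "s k" "U k"] sP UP by (simp add: dominated_space_simps)
      show ?thesis using multilinear_mapD(2)[OF Tm False]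
        multilinear_mapD(2)[OF pos_dominatedD(2)[OF P] False] by simp
    qed
  qed
  then have TP: "T \<in> \<D>"
    using D.closed(3)[of "s k" "U k"] sP UP by (simp add: dominated_space_simps)
  have diff: "s n \<ominus>\<^bsub>dominated_space\<^esub> T = U n" for n
    using TP by (subst D.minus_smult) (simp_all add: dominated_space_simps U_def)
  have "D.vlim s T"
    unfolding D.vlim_iff dominated_space_simps
  proof (intro conjI allI impI sP TP)
    fix e :: real assume e: "0 < e"
    then obtain N where N: "\<And>n. N \<le> n \<Longrightarrow> dbound (U n) (e / 2)" using small[of "e / 2"] by auto
    have "\<pi> (s n \<ominus>\<^bsub>dominated_space\<^esub> T) < e" if "N \<le> n" for n
      using pos_dominated_norm_le[OF N[OF that]] e by (simp add: diff)
    then show "\<exists>N. \<forall>n\<ge>N. \<pi> (s n \<ominus>\<^bsub>dominated_space\<^esub> T) < e" by blast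
  qed
  then show "\<exists>l. D.vlim s l" by blast
qed

section \<open>Finite rank operators, composition and normalisation\<close>

lemma rank_one_multilinear_map:
  assumes f: "\<And>j. f j \<in> dual K (E j)" and y: "y \<in> carrier X"
  shows "multilinear_map K E X (\<lambda>x\<in>prod_carrier E. (\<Prod>j\<in>UNIV. f j (x j)) \<odot>\<^bsub>X\<^esub> y)"
proof (intro multilinear_map_restrictI scalar_field_axioms normed_factors)
  have fK: "f j (x j) \<in> K" if "x \<in> prod_carrier E" for x j
    using dualD(1)[OF f] that by (simp add: prod_carrierD)
  have split: "(\<Prod>j\<in>UNIV. f j ((x(k := a)) j)) = f k a * (\<Prod>j\<in>UNIV - {k}. f j (x j))" for x k a
    by (subst prod.remove[of _ k]) (auto intro!: prod.cong)
  show "(\<Prod>j\<in>UNIV. f j (x j)) \<odot>\<^bsub>X\<^esub> y \<in> carrier X" if "x \<in> prod_carrier E" for x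
    using fK[OF that] y by (intro X.closed(5) prod_scalar_closed)
  fix x k a assume x: "x \<in> prod_carrier E" and a: "a \<in> carrier (E k)"
  have P: "(\<Prod>j\<in>UNIV - {k}. f j (x j)) \<in> K" using fK[OF x] by (intro prod_scalar_closed)
  have fa: "f k b \<in> K" if "b \<in> carrier (E k)" for b using dualD(1)[OF f that] .
  show "(\<Prod>j\<in>UNIV. f j ((x(k := a \<oplus>\<^bsub>E k\<^esub> b)) j)) \<odot>\<^bsub>X\<^esub> y
      = (\<Prod>j\<in>UNIV. f j ((x(k := a)) j)) \<odot>\<^bsub>X\<^esub> y \<oplus>\<^bsub>X\<^esub> (\<Prod>j\<in>UNIV. f j ((x(k := b)) j)) \<odot>\<^bsub>X\<^esub> y"
    if b: "b \<in> carrier (E k)" for b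
    unfolding split dualD(2)[OF f a b] distrib_right
    using P fa a b y by (intro X.smult_simps) auto
  show "(\<Prod>j\<in>UNIV. f j ((x(k := c \<odot>\<^bsub>E k\<^esub> a)) j)) \<odot>\<^bsub>X\<^esub> y
      = c \<odot>\<^bsub>X\<^esub> ((\<Prod>j\<in>UNIV. f j ((x(k := a)) j)) \<odot>\<^bsub>X\<^esub> y)" if c: "c \<in> K" for c
    unfolding split dualD(3)[OF f c a] mult.assoc
    using P fa a c y by (intro X.smult_simps) auto
qed

text \<open>
  Hoelder's inequality separates the coordinates, and each functional is then measured by the weak norm.
\<close>

lemma rank_one_dbound:
  assumes f: "\<And>j. f j \<in> dual K (E j)" and y: "y \<in> carrier X"
    and c: "\<And>j. 0 \<le> c j" "\<And>j a. a \<in> carrier (E j) \<Longrightarrow> cmod (f j a) \<le> c j * vnorm (E j) a"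
  shows "dbound (\<lambda>x\<in>prod_carrier E. (\<Prod>j\<in>UNIV. f j (x j)) \<odot>\<^bsub>X\<^esub> y) (vnorm X y * (\<Prod>j\<in>UNIV. c j))"
proof (rule dboundI)
  fix n :: nat and x :: "nat \<Rightarrow> 'm \<Rightarrow> 'a"
  assume nx: "0 < n" "\<And>i j. i < n \<Longrightarrow> x i j \<in> pos_cone (E j)"
  have xc: "x i j \<in> carrier (E j)" if "i < n" for i j using nx(2)[OF that] by (rule B.pos_cone_carrier)
  let ?T = "\<lambda>x\<in>prod_carrier E. (\<Prod>j\<in>UNIV. f j (x j)) \<odot>\<^bsub>X\<^esub> y"
  have "lp_norm p n (\<lambda>i. vnorm X (?T (x i)))
      = lp_norm p n (\<lambda>i. vnorm X y * (\<Prod>j\<in>UNIV. cmod (f j (x i j))))"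
  proof (rule lp_norm_cong)
    fix i assume i: "i < n"
    have "(\<Prod>j\<in>UNIV. f j (x i j)) \<in> K"
      using dualD(1)[OF f xc[OF i]] by (rule prod_scalar_closed)
    moreover have "x i \<in> prod_carrier E" using xc[OF i] by (simp add: prod_carrier_def)
    ultimately show "vnorm X (?T (x i)) = vnorm X y * (\<Prod>j\<in>UNIV. cmod (f j (x i j)))"
      using y by (simp add: X.vnorm_props prod_norm[symmetric])
  qed
  also have "\<dots> = vnorm X y * lp_norm p n (\<lambda>i. \<Prod>j\<in>UNIV. cmod (f j (x i j)))"
    using y by (intro lp_norm_scale[OF nx(1) p_ge]) (auto simp: X.vnorm_props intro!: prod_nonneg)
  also have "\<dots> \<le> vnorm X y * (\<Prod>j\<in>UNIV. lp_norm (ps j) n (\<lambda>i. cmod (f j (x i j))))"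
    using y by (intro mult_left_mono lp_norm_Holder[OF nx(1) p_ge ps_ge conj]) (auto simp: X.vnorm_props)
  also have "\<dots> \<le> vnorm X y * (\<Prod>j\<in>UNIV. c j * weak_norm K (E j) (ps j) n (\<lambda>i. x i j))"
    using y nx(1) xc c
    by (intro mult_left_mono prod_mono conjI E.lp_norm_functional_le f ps_ge lp_norm_nonneg)
      (auto simp: X.vnorm_props)
  finally show "lp_norm p n (\<lambda>i. vnorm X (?T (x i))) \<le> vnorm X y * (\<Prod>j\<in>UNIV. c j) * weak_prod n x"
    by (simp add: prod.distrib mult.assoc)
qed

lemma finite_rank_pos_dominated: "finite_rank_ops K E X \<subseteq> \<D>"
proof
  fix T assume "T \<in> finite_rank_ops K E X"
  then obtain k :: nat and f y where fy: "\<forall>i<k. \<forall>j. f i j \<in> dual K (E j)" "\<forall>i<k. y i \<in> carrier X"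
    and T: "T = (\<lambda>x\<in>prod_carrier E. finsum X (\<lambda>i. (\<Prod>j\<in>UNIV. f i j (x j)) \<odot>\<^bsub>X\<^esub> y i) {..<k})"
    unfolding finite_rank_ops_def by blast
  have f: "f i j \<in> dual K (E j)" and y: "y i \<in> carrier X" if "i < k" for i j using fy that by auto
  let ?g = "\<lambda>x i. (\<Prod>j\<in>UNIV. f i j (x j)) \<odot>\<^bsub>X\<^esub> y i"
  have "(\<lambda>x\<in>prod_carrier E. finsum X (?g x) {..<l}) \<in> \<D>" if "l \<le> k" for l
    using that
  proof (induction l)
    case 0
    then show ?case using zero_pos_dominated(1) by (simp del: restrict_apply)
  next
    case (Suc l)
    have one: "(\<lambda>x\<in>prod_carrier E. ?g x l) \<in> \<D>"
      using Suc.prems f y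
      by (intro pos_dominatedI[OF rank_one_multilinear_map
            rank_one_dbound[where c = "\<lambda>j. op_norm (E j) (scalar_space K) (f l j)"]]
          E.dual_le_op_norm mult_nonneg_nonneg prod_nonneg ballI X.vnorm_props
          op_norm_nonneg[OF scalar_field_axioms normed_factors normed_scalar_space]) auto
    have gc: "?g x i \<in> carrier X" if "i < k" "x \<in> prod_carrier E" for x i
      using dualD(1)[OF f[OF that(1)]] y[OF that(1)] prod_carrierD[OF that(2)]
      by (intro X.closed(5) prod_scalar_closed) auto
    have "finsum X (?g x) {..<Suc l} = finsum X (?g x) {..<l} \<oplus>\<^bsub>X\<^esub> ?g x l" if "x \<in> prod_carrier E" for x
      using gc[OF _ that] Suc.prems
      by (simp add: lessThan_Suc X.M.M.finsum_insert Pi_def X.M.M.finsum_closed X.M.M.a_comm)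
    then have eq: "(\<lambda>x\<in>prod_carrier E. finsum X (?g x) {..<Suc l}) = (\<lambda>x\<in>prod_carrier E.
        (\<lambda>x\<in>prod_carrier E. finsum X (?g x) {..<l}) x \<oplus>\<^bsub>X\<^esub> (\<lambda>x\<in>prod_carrier E. ?g x l) x)"
      by (intro restrict_ext) simp
    have "l \<le> k" using Suc.prems by simp
    then show ?case unfolding eq by (rule add_pos_dominated(1)[OF Suc.IH one])
  qed
  then show "T \<in> \<D>" unfolding T by simp
qed

end

locale dominated_composition =
  dominated_component K E X p ps + G: dominated_component K G Y p ps
  for K :: "complex set" and E :: "'m::finite \<Rightarrow> 'a lspace" and X :: "'b nspace"
    and p :: ennreal and ps :: "'m \<Rightarrow> ennreal" and G :: "'m \<Rightarrow> 'a lspace" and Y :: "'b nspace" +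
  fixes T u v
  assumes T: "T \<in> \<D>" and u: "\<And>j. u j \<in> pos_linear_ops K (G j) (E j)" and v: "v \<in> linear_ops K X Y"
begin

lemma u_linear: "u j \<in> linear_ops K (G j) (E j)"
  using u by (simp add: pos_linear_ops_def)

lemma u_pos: "a \<in> pos_cone (G j) \<Longrightarrow> u j a \<in> pos_cone (E j)"
  using u[of j] by (auto simp: pos_linear_ops_def)

lemma image_prod_carrier: "x \<in> prod_carrier G \<Longrightarrow> (\<lambda>j. u j (x j)) \<in> prod_carrier E"
  using linear_opsD(1)[OF u_linear] by (simp add: prod_carrier_def)

lemma compose_multilinear_map: "multilinear_map K G Y (compose_ops G v T u)"
  unfolding compose_ops_def
proof (intro multilinear_map_restrictI scalar_field_axioms G.normed_factors)
  note Tm = pos_dominatedD(2)[OF T]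
  have upd: "(\<lambda>j. u j ((x(k := a)) j)) = (\<lambda>j. u j (x j))(k := u k a)" for x k a by auto
  note ul = linear_opsD[OF u_linear] and vl = linear_opsD[OF v]
  show "v (T (\<lambda>j. u j (x j))) \<in> carrier Y" if "x \<in> prod_carrier G" for x
    using that by (intro vl multilinear_mapD(1)[OF Tm] image_prod_carrier)
  fix x k a assume x: "x \<in> prod_carrier G" and a: "a \<in> carrier (G k)"
  have Tc: "T ((\<lambda>j. u j (x j))(k := u k b)) \<in> carrier X" if "b \<in> carrier (G k)" for b
    using image_prod_carrier[OF x] ul(1)[OF that] by (intro multilinear_mapD(1)[OF Tm] prod_carrier_update)
  show "v (T (\<lambda>j. u j ((x(k := a \<oplus>\<^bsub>G k\<^esub> b)) j)))
      = v (T (\<lambda>j. u j ((x(k := a)) j))) \<oplus>\<^bsub>Y\<^esub> v (T (\<lambda>j. u j ((x(k := b)) j)))"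
    if b: "b \<in> carrier (G k)" for b
    unfolding upd ul(2)[OF a b] multilinear_mapD(3)[OF Tm image_prod_carrier[OF x] ul(1)[OF a] ul(1)[OF b]]
    by (rule vl(2)[OF Tc[OF a] Tc[OF b]])
  show "v (T (\<lambda>j. u j ((x(k := c \<odot>\<^bsub>G k\<^esub> a)) j))) = c \<odot>\<^bsub>Y\<^esub> v (T (\<lambda>j. u j ((x(k := a)) j)))"
    if c: "c \<in> K" for c
    unfolding upd ul(3)[OF c a] multilinear_mapD(4)[OF Tm image_prod_carrier[OF x] c ul(1)[OF a]]
    by (rule vl(3)[OF c Tc[OF a]])
qed

text \<open>
  Positivity of the \<open>u\<^sub>j\<close> is what allows domination of \<open>T\<close> to be applied to the image family.
\<close>

lemma compose_dbound:
  "G.dbound (compose_ops G v T u) (op_norm X Y v * \<pi> T * (\<Prod>j\<in>UNIV. op_norm (G j) (E j) (u j)))"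
proof (rule G.dboundI)
  fix n :: nat and x :: "nat \<Rightarrow> 'm \<Rightarrow> 'a"
  assume nx: "0 < n" "\<And>i j. i < n \<Longrightarrow> x i j \<in> pos_cone (G j)"
  define z where "z = (\<lambda>i j. u j (x i j))"
  have zp: "z i j \<in> pos_cone (E j)" if "i < n" for i j using nx(2)[OF that] by (simp add: z_def u_pos)
  have Tz: "T (z i) \<in> carrier X" if "i < n" for i
    using pos_cone_prod_carrier[OF zp[OF that]] by (rule multilinear_mapD(1)[OF pos_dominatedD(2)[OF T]])
  have v0: "0 \<le> op_norm X Y v"
    by (rule op_norm_nonneg[OF scalar_field_axioms normed_target G.normed_target v])
  have "lp_norm p n (\<lambda>i. vnorm Y (compose_ops G v T u (x i))) = lp_norm p n (\<lambda>i. vnorm Y (v (T (z i))))"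
    using nx(2) by (intro lp_norm_cong) (simp add: compose_ops_def G.pos_cone_prod_carrier z_def)
  also have "\<dots> \<le> lp_norm p n (\<lambda>i. op_norm X Y v * vnorm X (T (z i)))"
    using Tz by (intro lp_norm_mono[OF nx(1) p_ge] G.X.vnorm_props linear_opsD(1)[OF v]
        vnorm_le_op_norm[OF scalar_field_axioms normed_target G.normed_target v])
  also have "\<dots> = op_norm X Y v * lp_norm p n (\<lambda>i. vnorm X (T (z i)))"
    using Tz by (intro lp_norm_scale[OF nx(1) p_ge v0] X.vnorm_props)
  also have "\<dots> \<le> op_norm X Y v * (\<pi> T * weak_prod n z)"
    using dboundD[OF dbound_pos_dominated_norm[OF T] nx(1) zp] v0 by (rule mult_left_mono)
  also have "\<dots> \<le> op_norm X Y v * (\<pi> T *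
      (\<Prod>j\<in>UNIV. op_norm (G j) (E j) (u j) * weak_norm K (G j) (ps j) n (\<lambda>i. x i j)))"
  proof (intro mult_left_mono prod_mono conjI v0 pos_dominated_norm_nonneg[OF T])
    fix j
    show "0 \<le> weak_norm K (E j) (ps j) n (\<lambda>i. z i j)"
      using zp B.pos_cone_carrier by (intro E.weak_norm_nonneg ps_ge nx(1)) blast
    show "weak_norm K (E j) (ps j) n (\<lambda>i. z i j)
        \<le> op_norm (G j) (E j) (u j) * weak_norm K (G j) (ps j) n (\<lambda>i. x i j)"
      unfolding z_def using nx(2) G.B.pos_cone_carrier
      by (intro weak_norm_image_le[OF scalar_field_axioms G.normed_factors normed_factors u_linear ps_ge nx(1)]) blast
  qed
  finally show "lp_norm p n (\<lambda>i. vnorm Y (compose_ops G v T u (x i)))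
      \<le> op_norm X Y v * \<pi> T * (\<Prod>j\<in>UNIV. op_norm (G j) (E j) (u j)) * G.weak_prod n x"
    by (simp add: prod.distrib mult.assoc)
qed

lemma compose_bound_nonneg: "0 \<le> op_norm X Y v * \<pi> T * (\<Prod>j\<in>UNIV. op_norm (G j) (E j) (u j))"
  by (intro mult_nonneg_nonneg prod_nonneg ballI pos_dominated_norm_nonneg[OF T]
      op_norm_nonneg[OF scalar_field_axioms normed_target G.normed_target v]
      op_norm_nonneg[OF scalar_field_axioms G.normed_factors normed_factors u_linear])

lemma compose_pos_dominated:
  "compose_ops G v T u \<in> G.\<D>"
  "G.\<pi> (compose_ops G v T u) \<le> op_norm X Y v * \<pi> T * (\<Prod>j\<in>UNIV. op_norm (G j) (E j) (u j))"
  by (rule G.pos_dominatedI[OF compose_multilinear_map compose_dbound compose_bound_nonneg],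
      rule G.pos_dominated_norm_le[OF compose_dbound compose_bound_nonneg])

end

text \<open>
  Since \<open>g c = c (g 1)\<close>, the operator is of rank one with functionals of norm \<open>1\<close>, so \<open>1\<close> is a
  domination constant. No smaller one is possible: the positive \<open>e\<close> with \<open>f e = 1\<close> has norm \<open>1\<close> and
  is mapped to the unit vector \<open>g 1\<close>.
\<close>

lemma pos_dominated_norm_scalar_product:
  fixes S :: "'a lspace" and R :: "'b nspace" and ps :: "'m::finite \<Rightarrow> ennreal"
  assumes K: "scalar_field K" and ex: "conjugate_exponents p ps"
    and S: "banach_lattice K S" and f: "isometric_iso K S (scalar_lattice K) f"
    and fpos: "f ` pos_cone S = pos_cone (scalar_lattice K)"
    and R: "banach_space K R" and g: "isometric_iso K (scalar_space K) R g"
  shows "pos_dominated_norm K p ps (\<lambda>_. S) R (\<lambda>x\<in>prod_carrier (\<lambda>_. S). g (\<Prod>j\<in>UNIV. f (x j))) = 1"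
    (is "pos_dominated_norm K p ps ?E R ?T = 1")
proof -
  interpret scalar_field K by fact
  interpret conjugate_exponents p ps by fact
  interpret dominated_component K ?E R p ps using S R by unfold_locales
  have "linear_ops K S (scalar_lattice K) = dual K S"
    by (simp add: linear_ops_def scalar_lattice_def scalar_space_def)
  then have fd: "f \<in> dual K S" using f by (simp add: isometric_iso_def)
  have fn: "cmod (f a) = vnorm S a" if "a \<in> carrier S" for a
    using f that by (simp add: isometric_iso_def scalar_lattice_def)
  have gl: "g \<in> linear_ops K (scalar_space K) R" using g by (simp add: isometric_iso_def)
  have g1: "g 1 \<in> carrier R" "vnorm R (g 1) = 1"
    using linear_opsD(1)[OF gl, of 1] g by (auto simp: isometric_iso_def scalar_space_def)
  have gc: "g c = c \<odot>\<^bsub>R\<^esub> g 1" if "c \<in> K" for c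
    using linear_opsD(3)[OF gl that, of 1] by (simp add: scalar_space_def)
  have eq: "?T = (\<lambda>x\<in>prod_carrier ?E. (\<Prod>j\<in>UNIV. f (x j)) \<odot>\<^bsub>R\<^esub> g 1)"
    by (intro restrict_ext gc prod_scalar_closed dualD(1)[OF fd] prod_carrierD)
  have db: "dbound ?T 1"
    using rank_one_dbound[of "\<lambda>_. f" "g 1" "\<lambda>_. 1"] fd g1 fn unfolding eq by simp
  have "1 \<in> f ` pos_cone S" unfolding fpos by (simp add: pos_cone_def scalar_lattice_def)
  then obtain e where e: "e \<in> pos_cone S" "f e = 1" by auto
  have ec: "e \<in> carrier S" using B.pos_cone_carrier e(1) by blast
  have "1 \<le> C" if "0 < C" "dbound ?T C" for C
  proof -
    have "(\<lambda>_. e) \<in> prod_carrier ?E" using ec by (simp add: prod_carrier_def)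
    then have "1 = lp_norm p 1 (\<lambda>i. vnorm R (?T (\<lambda>_. e)))"
      using lp_norm_single[OF p_ge, of "\<lambda>_. 1"] e g1 by simp
    also have "\<dots> \<le> C * weak_prod 1 (\<lambda>_ _. e)"
      using dboundD[OF that(2), of 1 "\<lambda>_ _. e"] e by simp
    also have "\<dots> \<le> C * (\<Prod>j\<in>(UNIV::'m set). vnorm S e)"
      using that ec by (intro mult_left_mono prod_mono conjI E.weak_norm_single_le E.weak_norm_nonneg ps_ge) auto
    also have "\<dots> = C" using fn[OF ec] e by simp
    finally show ?thesis .
  qed
  then have "1 \<le> pos_dominated_norm K p ps ?E R ?T"
    unfolding pos_dominated_norm_def using db by (intro cInf_greatest) (auto intro!: exI[of _ 1])
  then show ?thesis using pos_dominated_norm_le[OF db] by simp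
qed

section \<open>The multi-ideal\<close>

theorem proposition3p8:
  fixes K :: "complex set" and p :: ennreal and ps :: "'m::finite \<Rightarrow> ennreal"
  assumes "K = \<real> \<or> K = UNIV"
    and "1 \<le> p" and "\<And>j. 1 \<le> ps j"
    and "1 / p = (\<Sum>j\<in>UNIV. 1 / ps j)"
  shows "positive_banach_right_multi_ideal K
           (pos_dominated K p ps :: ('m \<Rightarrow> 'a lspace) \<Rightarrow> 'b nspace \<Rightarrow> (('m \<Rightarrow> 'a) \<Rightarrow> 'b) set)
           (pos_dominated_norm K p ps)"
proof -
  have K: "scalar_field K" and ex: "conjugate_exponents p ps"
    using assms by (simp_all add: scalar_field_def conjugate_exponents_def)
  have comp: "dominated_component K E X p ps"
    if "\<And>j. banach_lattice K (E j)" "banach_space K X" for E :: "'m \<Rightarrow> 'a lspace" and X :: "'b nspace"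
    using that K ex
    by (simp add: dominated_component_def multi_lattices_def multi_lattices_axioms_def)
  have compos: "dominated_composition K E X p ps G Y T u v"
    if "\<And>j. banach_lattice K (E j)" "banach_space K X" "\<And>j. banach_lattice K (G j)" "banach_space K Y"
      "T \<in> pos_dominated K p ps E X" "\<And>j. u j \<in> pos_linear_ops K (G j) (E j)" "v \<in> linear_ops K X Y"
    for E G :: "'m \<Rightarrow> 'a lspace" and X Y :: "'b nspace" and T u v
    using that comp by (simp add: dominated_composition_def dominated_composition_axioms_def)
  show ?thesis
    unfolding positive_banach_right_multi_ideal_def
  proof (intro conjI allI impI; (elim conjE)?)
    fix E :: "'m \<Rightarrow> 'a lspace" and X :: "'b nspace"
    assume "\<forall>j. banach_lattice K (E j)" "banach_space K X"
    then interpret dominated_component K E X p ps by (intro comp) auto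
    show "submodule \<D> (scalar_ring K) (multilinear_space K E X)" by (rule submodule_pos_dominated)
    show "finite_rank_ops K E X \<subseteq> \<D>" by (rule finite_rank_pos_dominated)
    show "banach_space K (multilinear_space K E X \<lparr>carrier := \<D>, vnorm := \<pi>\<rparr>)"
      using banach_dominated_space by (simp add: dominated_space_def)
  next
    fix E G :: "'m \<Rightarrow> 'a lspace" and X Y :: "'b nspace" and T u v
    assume "\<forall>j. banach_lattice K (E j)" "banach_space K X" "\<forall>j. banach_lattice K (G j)" "banach_space K Y"
      "T \<in> pos_dominated K p ps E X" "\<forall>j. u j \<in> pos_linear_ops K (G j) (E j)" "v \<in> linear_ops K X Y"
    then interpret dominated_composition K E X p ps G Y T u v by (intro compos) auto
    show "compose_ops G v T u \<in> pos_dominated K p ps G Y"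
      and "pos_dominated_norm K p ps G Y (compose_ops G v T u)
        \<le> op_norm X Y v * pos_dominated_norm K p ps E X T * (\<Prod>j\<in>UNIV. op_norm (G j) (E j) (u j))"
      by (rule compose_pos_dominated)+
  next
    fix S :: "'a lspace" and R :: "'b nspace" and f g
    assume "banach_lattice K S" "isometric_iso K S (scalar_lattice K) f"
      "f ` pos_cone S = pos_cone (scalar_lattice K)" "banach_space K R" "isometric_iso K (scalar_space K) R g"
    then show "pos_dominated_norm K p ps (\<lambda>_. S) R (\<lambda>x\<in>prod_carrier (\<lambda>_. S). g (\<Prod>j\<in>UNIV. f (x j))) = 1"
      by (rule pos_dominated_norm_scalar_product[OF K ex])
  qed
qed

end
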